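(* Let $T>0$, $I=[-T,T]$, let $m\in\mathbb{R}$ with $m\neq k\pi/T$ for all $k\in\mathbb{Z}$, and let $h\in L^1(I)$. Then the problem $$x'(t)+m\,x(-t)=h(t),\quad t\in I,\qquad x(T)-x(-T)=0,$$ has a unique solution, given by $$u(t):=\int_{-T}^{T}\overline{G}(t,s)\,h(s)\,ds,\qquad \overline{G}(t,s):=m\,G(t,-s)-\frac{\partial G}{\partial s}(t,s),$$ where $G$ is the Green's function of the periodic problem $x''+m^2x=f$ on $I$, $x(T)=x(-T)$, $x'(T)=x'(-T)$.
   Context: For $m\ne k\pi/T$ ($k\in\mathbb{Z}$), the Green's function $G$ of the periodic problem $x''(t)+m^2x(t)=f(t)$, $t\in I$, $x(T)-x(-T)=0$, $x'(T)-x'(-T)=0$, is the unique continuous function $G:I^2\to\mathbb{R}$ such that, for every continuous $f$ on $I$, the unique solution of this problem is $u(t)=\int_{-T}^{T}G(t,s)f(s)\,ds$. The function $\overline G$ is defined for $t\neq s$ (the diagonal has measure zero in $s$ for each $t$ and does not affect the integral). A solution of the first order problem with $h\in L^1(I)$ is an absolutely continuous function on $I$ satisfying the equation almost everywhere on $I$ together with the boundary condition. *)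

theory Defs
  imports "HOL-Analysis.Analysis"
begin

text \<open>Absolute continuity of a real function on a set \<open>S\<close> (in the applications a compact interval), in
  the \<open>\<epsilon>\<close>-\<open>\<delta>\<close> form. The constant \<^const>\<open>absolutely_continuous\<close> of the library concerns pairs of
  measures and is unrelated.\<close>

definition abs_continuous_on :: "real set \<Rightarrow> (real \<Rightarrow> real) \<Rightarrow> bool" where
  "abs_continuous_on S f \<longleftrightarrow>
     (\<forall>\<epsilon>>0. \<exists>\<delta>>0. \<forall>(n::nat) a b.
        (\<forall>i<n. a i \<le> b i \<and> {a i..b i} \<subseteq> S) \<and>
        (\<forall>i<n. \<forall>j<n. i \<noteq> j \<longrightarrow> {a i<..<b i} \<inter> {a j<..<b j} = {}) \<and>
        (\<Sum>i<n. b i - a i) < \<delta>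
        \<longrightarrow> (\<Sum>i<n. \<bar>f (b i) - f (a i)\<bar>) < \<epsilon>)"

text \<open>Functions on \<open>I = [-T, T]\<close> are total functions whose values off \<open>I\<close> are ignored; derivatives
  are taken within \<open>I\<close>, hence one-sidedly at \<open>\<plusminus>T\<close>.\<close>

text \<open>\<open>x'' + m\<^sup>2 x = f\<close> on \<open>I\<close>, \<open>x(T) = x(-T)\<close>, \<open>x'(T) = x'(-T)\<close>; the function \<open>x'\<close> below is
  the derivative of \<open>x\<close>, and \<open>x''(t) = f(t) - m\<^sup>2 x(t)\<close>.\<close>

definition periodic_solution2 ::
    "real \<Rightarrow> real \<Rightarrow> (real \<Rightarrow> real) \<Rightarrow> (real \<Rightarrow> real) \<Rightarrow> bool" where
  "periodic_solution2 T m f x \<longleftrightarrow>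
     (\<exists>x'. (\<forall>t\<in>{-T..T}. (x has_real_derivative x' t) (at t within {-T..T})) \<and>
           (\<forall>t\<in>{-T..T}. (x' has_real_derivative (f t - m\<^sup>2 * x t)) (at t within {-T..T})) \<and>
           x T - x (-T) = 0 \<and> x' T - x' (-T) = 0)"

definition is_green_function :: "real \<Rightarrow> real \<Rightarrow> (real \<Rightarrow> real \<Rightarrow> real) \<Rightarrow> bool" where
  "is_green_function T m G \<longleftrightarrow>
     continuous_on ({-T..T} \<times> {-T..T}) (\<lambda>(t, s). G t s) \<and>
     (\<forall>f. continuous_on {-T..T} f \<longrightarrow>
        (let u = (\<lambda>t. LINT s:{-T..T}|lebesgue. G t s * f s) in
           periodic_solution2 T m f u \<and>
           (\<forall>x. periodic_solution2 T m f x \<longrightarrow> (\<forall>t\<in>{-T..T}. x t = u t))))"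

text \<open>The Green's function is unique only as a function on \<open>I \<times> I\<close>; extending it by 0 makes it
  unique as a total function, so that \<^const>\<open>The\<close> applies.\<close>

definition green_function :: "real \<Rightarrow> real \<Rightarrow> real \<Rightarrow> real \<Rightarrow> real" where
  "green_function T m =
     (THE G. is_green_function T m G \<and> (\<forall>t s. (t, s) \<notin> {-T..T} \<times> {-T..T} \<longrightarrow> G t s = 0))"

text \<open>\<open>m G(t, -s) - \<partial>G/\<partial>s(t, s)\<close>, meaningful for \<open>t \<noteq> s\<close>; the value at \<open>t = s\<close> is unspecified.\<close>

definition green_bar :: "real \<Rightarrow> real \<Rightarrow> real \<Rightarrow> real \<Rightarrow> real" where
  "green_bar T m t s =
     m * green_function T m t (-s)
       - vector_derivative (\<lambda>\<sigma>. green_function T m t \<sigma>) (at s within {-T..T})"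

definition reflection_solution ::
    "real \<Rightarrow> real \<Rightarrow> (real \<Rightarrow> real) \<Rightarrow> (real \<Rightarrow> real) \<Rightarrow> bool" where
  "reflection_solution T m h x \<longleftrightarrow>
     abs_continuous_on {-T..T} x \<and>
     (AE t\<in>{-T..T} in lebesgue.
        (x has_real_derivative (h t - m * x (-t))) (at t within {-T..T})) \<and>
     x T - x (-T) = 0"

end

theory Submission
  imports Defs
begin

text \<open>
  \<^bold>\<open>Existence.\<close> Write \<open>I = [-T, T]\<close>. The condition on \<open>m\<close> says that \<open>m \<noteq> 0\<close> and \<open>sin (m T) \<noteq> 0\<close>
  (\<open>nonresonant\<close>), and then the Green's function of the periodic problem is
  \<open>G(t, s) = cos (m (T - \<bar>t - s\<bar>)) / (2 m sin (m T))\<close> on \<open>I \<times> I\<close> (\<open>green_function_eq_kernel\<close>).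
  Hence, for \<open>s \<noteq> t\<close>, the kernel of the theorem multiplied by \<open>2 sin (m T)\<close> is
  \<open>cos (m (T - \<bar>t + s\<bar>)) + sgn (t - s) sin (m (T - \<bar>t - s\<bar>))\<close> (\<open>green_bar_formula\<close>). To the left
  and to the right of its corner, at \<open>s = -t\<close> or \<open>s = t\<close>, each of the two terms is a
  combination of \<open>cos (m s)\<close> and \<open>sin (m s)\<close> with coefficients depending on \<open>t\<close>. So \<open>u\<close> is a
  combination, with trigonometric coefficients in \<open>t\<close>, of the values at \<open>t\<close>, \<open>-t\<close> and \<open>T\<close> of the two
  indefinite integrals \<open>C\<close> and \<open>S\<close> of \<open>cos (m s) h(s)\<close> and \<open>sin (m s) h(s)\<close>. These
  are absolutely continuous and, by Lebesgue's differentiation theorem, have the integrand as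
  derivative almost everywhere. Differentiating \<open>u\<close> at such points, the terms containing \<open>h(-t)\<close> cancel, those
  containing \<open>h(t)\<close> add up to \<open>h(t)\<close>, and what remains is \<open>-m u(-t)\<close>
  (\<open>reflection_numerator_has_derivative\<close>).

  \<^bold>\<open>Uniqueness.\<close> The difference \<open>z\<close> of two solutions satisfies \<open>z'(t) = -m z(-t)\<close> almost everywhere.
  Being absolutely continuous, \<open>z\<close> is the integral of its derivative, and as the right-hand side is
  continuous the equation holds everywhere. Differentiating once more gives \<open>z'' = -m\<^sup>2 z\<close>, and
  \<open>z'(T) = -m z(-T) = -m z(T) = z'(-T)\<close>, so \<open>z\<close> solves the homogeneous periodic problem of second
  order and vanishes (\<open>reflection_solution_zero_unique\<close>).

  Two facts of real analysis carry this: an absolutely continuous function is the integral of its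
  almost everywhere derivative (\<open>abs_continuous_has_integral\<close>), and an indefinite integral has the
  integrand as derivative almost everywhere (\<open>indefinite_integral_has_real_derivative_ae\<close>). Both are
  proved with the gauge integral, the second by combining Henstock's lemma with Vitali's covering
  theorem.
\<close>

section \<open>Absolutely continuous functions\<close>

lemma abs_continuous_onI:
  assumes "\<And>\<epsilon>. \<epsilon> > 0 \<Longrightarrow> \<exists>\<delta>>0. \<forall>(n::nat) a b.
        (\<forall>i<n. a i \<le> b i \<and> {a i..b i} \<subseteq> S) \<longrightarrow>
        (\<forall>i<n. \<forall>j<n. i \<noteq> j \<longrightarrow> {a i<..<b i} \<inter> {a j<..<b j} = {}) \<longrightarrow>
        (\<Sum>i<n. b i - a i) < \<delta> \<longrightarrow> (\<Sum>i<n. \<bar>f (b i) - f (a i)\<bar>) < \<epsilon>"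
  shows "abs_continuous_on S f"
  unfolding abs_continuous_on_def imp_conjL by (intro allI impI assms)

lemma abs_continuous_onE:
  assumes "abs_continuous_on S f" "\<epsilon> > 0"
  obtains \<delta> where "\<delta> > 0" "\<forall>(n::nat) a b.
        (\<forall>i<n. a i \<le> b i \<and> {a i..b i} \<subseteq> S) \<longrightarrow>
        (\<forall>i<n. \<forall>j<n. i \<noteq> j \<longrightarrow> {a i<..<b i} \<inter> {a j<..<b j} = {}) \<longrightarrow>
        (\<Sum>i<n. b i - a i) < \<delta> \<longrightarrow> (\<Sum>i<n. \<bar>f (b i) - f (a i)\<bar>) < \<epsilon>"
  using assms(1)[unfolded abs_continuous_on_def imp_conjL, rule_format, OF assms(2)] that
  by (elim exE conjE)

text \<open>Tagged divisions are finite sets of pairs; this transfers the \<open>\<epsilon>\<close>-\<open>\<delta>\<close> condition from families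
  indexed by an initial segment of the naturals to families indexed by any finite set.\<close>

lemma sum_variation_less_finite_family:
  fixes f :: "real \<Rightarrow> real" and a b :: "'j \<Rightarrow> real"
  assumes \<delta>: "\<forall>(n::nat) a b. (\<forall>i<n. a i \<le> b i \<and> {a i..b i} \<subseteq> S) \<longrightarrow>
        (\<forall>i<n. \<forall>j<n. i \<noteq> j \<longrightarrow> {a i<..<b i} \<inter> {a j<..<b j} = {}) \<longrightarrow>
        (\<Sum>i<n. b i - a i) < \<delta> \<longrightarrow> (\<Sum>i<n. \<bar>f (b i) - f (a i)\<bar>) < \<epsilon>"
    and J: "finite J" "\<And>j. j \<in> J \<Longrightarrow> a j \<le> b j \<and> {a j..b j} \<subseteq> S"
      "\<And>i j. \<lbrakk>i \<in> J; j \<in> J; i \<noteq> j\<rbrakk> \<Longrightarrow> {a i<..<b i} \<inter> {a j<..<b j} = {}"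
      "(\<Sum>j\<in>J. b j - a j) < \<delta>"
  shows "(\<Sum>j\<in>J. \<bar>f (b j) - f (a j)\<bar>) < \<epsilon>"
proof -
  obtain e where e: "bij_betw e {..<card J} J"
    using ex_bij_betw_nat_finite[OF \<open>finite J\<close>] by (auto simp: atLeast0LessThan)
  have sum_e: "(\<Sum>j\<in>J. w j) = (\<Sum>i<card J. w (e i))" for w :: "'j \<Rightarrow> real"
    using sum.reindex_bij_betw[OF e, of w] by simp
  have eJ: "e i \<in> J" if "i < card J" for i
    using e that by (auto simp: bij_betw_def)
  have inj: "e i \<noteq> e j" if "i < card J" "j < card J" "i \<noteq> j" for i j
    using e that by (auto simp: bij_betw_def inj_on_def)
  show ?thesis
    unfolding sum_e
  proof (rule \<delta>[rule_format])
    show "a (e i) \<le> b (e i) \<and> {a (e i)..b (e i)} \<subseteq> S" if "i < card J" for i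
      by (rule J(2)[OF eJ[OF that]])
    show "{a (e i)<..<b (e i)} \<inter> {a (e j)<..<b (e j)} = {}"
      if "i < card J" "j < card J" "i \<noteq> j" for i j
      by (rule J(3)[OF eJ eJ inj]) (use that in auto)
    show "(\<Sum>i<card J. b (e i) - a (e i)) < \<delta>"
      using J(4) unfolding sum_e .
  qed
qed

text \<open>Sums, products and Lipschitz functions all reduce to this one comparison: with \<open>g = h = id\<close> it covers
  Lipschitz functions, and for bounded \<open>g\<close> and \<open>h\<close> it covers their product.\<close>

lemma abs_continuous_on_dominated:
  assumes g: "abs_continuous_on S g" and h: "abs_continuous_on S h" and "K \<ge> 0"
    and le: "\<And>a b. \<lbrakk>a \<le> b; {a..b} \<subseteq> S\<rbrakk>
               \<Longrightarrow> \<bar>f b - f a\<bar> \<le> K * (\<bar>g b - g a\<bar> + \<bar>h b - h a\<bar>)"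
  shows "abs_continuous_on S f"
proof (rule abs_continuous_onI)
  fix \<epsilon> :: real assume "\<epsilon> > 0"
  \<comment> \<open>\<open>K + 1\<close> instead of \<open>K\<close> allows for \<open>K = 0\<close> and makes the final inequality strict.\<close>
  define \<epsilon>' where "\<epsilon>' = \<epsilon> / (K + 1) / 2"
  have "\<epsilon>' > 0" using \<open>\<epsilon> > 0\<close> \<open>K \<ge> 0\<close> by (simp add: \<epsilon>'_def)
  obtain \<delta>1 where "\<delta>1 > 0"
    and 1: "\<forall>(n::nat) a b. (\<forall>i<n. a i \<le> b i \<and> {a i..b i} \<subseteq> S) \<longrightarrow>
        (\<forall>i<n. \<forall>j<n. i \<noteq> j \<longrightarrow> {a i<..<b i} \<inter> {a j<..<b j} = {}) \<longrightarrow>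
        (\<Sum>i<n. b i - a i) < \<delta>1 \<longrightarrow> (\<Sum>i<n. \<bar>g (b i) - g (a i)\<bar>) < \<epsilon>'"
    by (rule abs_continuous_onE[OF g \<open>\<epsilon>' > 0\<close>])
  obtain \<delta>2 where "\<delta>2 > 0"
    and 2: "\<forall>(n::nat) a b. (\<forall>i<n. a i \<le> b i \<and> {a i..b i} \<subseteq> S) \<longrightarrow>
        (\<forall>i<n. \<forall>j<n. i \<noteq> j \<longrightarrow> {a i<..<b i} \<inter> {a j<..<b j} = {}) \<longrightarrow>
        (\<Sum>i<n. b i - a i) < \<delta>2 \<longrightarrow> (\<Sum>i<n. \<bar>h (b i) - h (a i)\<bar>) < \<epsilon>'"
    by (rule abs_continuous_onE[OF h \<open>\<epsilon>' > 0\<close>])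
  show "\<exists>\<delta>>0. \<forall>(n::nat) a b.
        (\<forall>i<n. a i \<le> b i \<and> {a i..b i} \<subseteq> S) \<longrightarrow>
        (\<forall>i<n. \<forall>j<n. i \<noteq> j \<longrightarrow> {a i<..<b i} \<inter> {a j<..<b j} = {}) \<longrightarrow>
        (\<Sum>i<n. b i - a i) < \<delta>
        \<longrightarrow> (\<Sum>i<n. \<bar>f (b i) - f (a i)\<bar>) < \<epsilon>"
  proof (intro exI[of _ "min \<delta>1 \<delta>2"] conjI allI impI)
    show "min \<delta>1 \<delta>2 > 0" using \<open>\<delta>1 > 0\<close> \<open>\<delta>2 > 0\<close> by simp
    fix n :: nat and a b
    assume fam: "\<forall>i<n. a i \<le> b i \<and> {a i..b i} \<subseteq> S"
        "\<forall>i<n. \<forall>j<n. i \<noteq> j \<longrightarrow> {a i<..<b i} \<inter> {a j<..<b j} = {}"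
        "(\<Sum>i<n. b i - a i) < min \<delta>1 \<delta>2"
    have g_small: "(\<Sum>i<n. \<bar>g (b i) - g (a i)\<bar>) < \<epsilon>'"
      by (rule 1[rule_format]) (use fam in auto)
    have h_small: "(\<Sum>i<n. \<bar>h (b i) - h (a i)\<bar>) < \<epsilon>'"
      by (rule 2[rule_format]) (use fam in auto)
    have "(\<Sum>i<n. \<bar>f (b i) - f (a i)\<bar>)
          \<le> (\<Sum>i<n. K * (\<bar>g (b i) - g (a i)\<bar> + \<bar>h (b i) - h (a i)\<bar>))"
      by (intro sum_mono le) (use fam in auto)
    also have "\<dots> = K * ((\<Sum>i<n. \<bar>g (b i) - g (a i)\<bar>) + (\<Sum>i<n. \<bar>h (b i) - h (a i)\<bar>))"
      by (simp add: sum_distrib_left[symmetric] sum.distrib)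
    also have "\<dots> \<le> K * (\<epsilon>' + \<epsilon>')"
      using g_small h_small \<open>K \<ge> 0\<close> by (intro mult_left_mono add_mono) auto
    also have "\<epsilon>' + \<epsilon>' = \<epsilon> / (K + 1)"
      unfolding \<epsilon>'_def by (rule field_sum_of_halves)
    also have "K * (\<epsilon> / (K + 1)) = K / (K + 1) * \<epsilon>" by simp
    also have "\<dots> < 1 * \<epsilon>"
      using \<open>K \<ge> 0\<close> \<open>\<epsilon> > 0\<close> by (intro mult_strict_right_mono) (auto simp: divide_simps)
    finally show "(\<Sum>i<n. \<bar>f (b i) - f (a i)\<bar>) < \<epsilon>" by simp
  qed
qed

lemma abs_continuous_on_id: "abs_continuous_on S (\<lambda>x. x)"
proof (rule abs_continuous_onI)
  fix \<epsilon> :: real assume "\<epsilon> > 0"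
  have "(\<Sum>i<n. \<bar>b i - a i\<bar>) = (\<Sum>i<n. b i - a i)" if "\<forall>i<n. a i \<le> b i" for n :: nat and a b :: "nat \<Rightarrow> real"
    using that by (intro sum.cong) auto
  with \<open>\<epsilon> > 0\<close> show "\<exists>\<delta>>0. \<forall>(n::nat) a b.
        (\<forall>i<n. a i \<le> b i \<and> {a i..b i} \<subseteq> S) \<longrightarrow>
        (\<forall>i<n. \<forall>j<n. i \<noteq> j \<longrightarrow> {a i<..<b i} \<inter> {a j<..<b j} = {}) \<longrightarrow>
        (\<Sum>i<n. b i - a i) < \<delta> \<longrightarrow> (\<Sum>i<n. \<bar>b i - a i\<bar>) < \<epsilon>"
    by (intro exI[of _ \<epsilon>]) auto
qed

lemma abs_continuous_on_lipschitz:
  assumes "K \<ge> 0" "\<And>x y. \<lbrakk>x \<in> S; y \<in> S\<rbrakk> \<Longrightarrow> \<bar>f y - f x\<bar> \<le> K * \<bar>y - x\<bar>"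
  shows "abs_continuous_on S f"
proof (rule abs_continuous_on_dominated[OF abs_continuous_on_id abs_continuous_on_id \<open>K \<ge> 0\<close>])
  fix a b :: real assume "a \<le> b" "{a..b} \<subseteq> S"
  then have "a \<in> S" "b \<in> S" by auto
  then have "\<bar>f b - f a\<bar> \<le> K * \<bar>b - a\<bar>" by (rule assms)
  also have "\<dots> \<le> K * (\<bar>b - a\<bar> + \<bar>b - a\<bar>)"
    using \<open>K \<ge> 0\<close> by (intro mult_left_mono) auto
  finally show "\<bar>f b - f a\<bar> \<le> K * (\<bar>b - a\<bar> + \<bar>b - a\<bar>)" .
qed

lemma abs_continuous_on_cong:
  assumes "abs_continuous_on S f" "\<And>x. x \<in> S \<Longrightarrow> f x = g x"
  shows "abs_continuous_on S g"
proof (rule abs_continuous_on_dominated[OF assms(1,1), of 1])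
  fix a b :: real assume "a \<le> b" "{a..b} \<subseteq> S"
  then have "a \<in> S" "b \<in> S" by auto
  then show "\<bar>g b - g a\<bar> \<le> 1 * (\<bar>f b - f a\<bar> + \<bar>f b - f a\<bar>)" using assms(2) by simp
qed simp

lemma abs_continuous_on_add:
  assumes "abs_continuous_on S f" "abs_continuous_on S g"
  shows "abs_continuous_on S (\<lambda>x. f x + g x)"
  by (rule abs_continuous_on_dominated[OF assms, of 1]) auto

lemma abs_continuous_on_diff:
  assumes "abs_continuous_on S f" "abs_continuous_on S g"
  shows "abs_continuous_on S (\<lambda>x. f x - g x)"
  by (rule abs_continuous_on_dominated[OF assms, of 1]) auto

lemma abs_continuous_on_const: "abs_continuous_on S (\<lambda>x. c)"
  by (rule abs_continuous_on_lipschitz[of 0]) auto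

lemma abs_continuous_on_imp_continuous_on:
  assumes "abs_continuous_on {c..d} f"
  shows "continuous_on {c..d} f"
  unfolding continuous_on_iff
proof (intro ballI allI impI)
  fix x \<epsilon> :: real assume "x \<in> {c..d}" "\<epsilon> > 0"
  obtain \<delta> where "\<delta> > 0"
    and \<delta>: "\<forall>(n::nat) a b. (\<forall>i<n. a i \<le> b i \<and> {a i..b i} \<subseteq> {c..d}) \<longrightarrow>
        (\<forall>i<n. \<forall>j<n. i \<noteq> j \<longrightarrow> {a i<..<b i} \<inter> {a j<..<b j} = {}) \<longrightarrow>
        (\<Sum>i<n. b i - a i) < \<delta> \<longrightarrow> (\<Sum>i<n. \<bar>f (b i) - f (a i)\<bar>) < \<epsilon>"
    by (rule abs_continuous_onE[OF assms \<open>\<epsilon> > 0\<close>])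
  have "dist (f y) (f x) < \<epsilon>" if "y \<in> {c..d}" "dist y x < \<delta>" for y
  proof (cases "x \<le> y")
    case True
    then show ?thesis
      using \<delta>[rule_format, of 1 "\<lambda>_. x" "\<lambda>_. y"] that \<open>x \<in> {c..d}\<close>
      by (auto simp: dist_real_def)
  next
    case False
    then show ?thesis
      using \<delta>[rule_format, of 1 "\<lambda>_. y" "\<lambda>_. x"] that \<open>x \<in> {c..d}\<close>
      by (auto simp: dist_real_def)
  qed
  with \<open>\<delta> > 0\<close> show "\<exists>\<delta>>0. \<forall>y\<in>{c..d}. dist y x < \<delta> \<longrightarrow> dist (f y) (f x) < \<epsilon>" by blast
qed

lemma abs_continuous_on_mult:
  assumes f: "abs_continuous_on {c..d} f" and g: "abs_continuous_on {c..d} g"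
  shows "abs_continuous_on {c..d} (\<lambda>x. f x * g x)"
proof -
  have bdd: "\<exists>B\<ge>0. \<forall>x\<in>{c..d}. \<bar>p x\<bar> \<le> B" if "abs_continuous_on {c..d} p" for p
  proof -
    have "bounded (p ` {c..d})"
      by (intro compact_imp_bounded compact_continuous_image
          abs_continuous_on_imp_continuous_on that) auto
    then obtain B where "\<forall>x\<in>{c..d}. \<bar>p x\<bar> \<le> B" by (auto simp: bounded_iff)
    then show ?thesis by (intro exI[of _ "max B 0"]) auto
  qed
  obtain B where B: "B \<ge> 0" "\<And>x. x \<in> {c..d} \<Longrightarrow> \<bar>f x\<bar> \<le> B" using bdd[OF f] by auto
  obtain B' where B': "B' \<ge> 0" "\<And>x. x \<in> {c..d} \<Longrightarrow> \<bar>g x\<bar> \<le> B'" using bdd[OF g] by auto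
  show ?thesis
  proof (rule abs_continuous_on_dominated[OF f g])
    show "B + B' \<ge> 0" using B B' by simp
    fix a b :: real assume "a \<le> b" "{a..b} \<subseteq> {c..d}"
    then have ab: "a \<in> {c..d}" "b \<in> {c..d}" by auto
    have "f b * g b - f a * g a = f b * (g b - g a) + g a * (f b - f a)"
      by (simp add: algebra_simps)
    then have "\<bar>f b * g b - f a * g a\<bar> \<le> \<bar>f b\<bar> * \<bar>g b - g a\<bar> + \<bar>g a\<bar> * \<bar>f b - f a\<bar>"
      by (metis abs_mult abs_triangle_ineq)
    also have "\<dots> \<le> (B + B') * \<bar>g b - g a\<bar> + (B + B') * \<bar>f b - f a\<bar>"
      using B(2)[OF ab(2)] B'(2)[OF ab(1)] B(1) B'(1)
      by (intro add_mono mult_right_mono) auto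
    finally show "\<bar>f b * g b - f a * g a\<bar> \<le> (B + B') * (\<bar>f b - f a\<bar> + \<bar>g b - g a\<bar>)"
      by (simp add: algebra_simps)
  qed
qed

lemma abs_continuous_on_reflect:
  assumes f: "abs_continuous_on {-T..T} f"
  shows "abs_continuous_on {-T..T} (\<lambda>x. f (- x))"
proof (rule abs_continuous_onI)
  fix \<epsilon> :: real assume "\<epsilon> > 0"
  obtain \<delta> where "\<delta> > 0"
    and \<delta>: "\<forall>(n::nat) a b. (\<forall>i<n. a i \<le> b i \<and> {a i..b i} \<subseteq> {-T..T}) \<longrightarrow>
        (\<forall>i<n. \<forall>j<n. i \<noteq> j \<longrightarrow> {a i<..<b i} \<inter> {a j<..<b j} = {}) \<longrightarrow>
        (\<Sum>i<n. b i - a i) < \<delta> \<longrightarrow> (\<Sum>i<n. \<bar>f (b i) - f (a i)\<bar>) < \<epsilon>"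
    by (rule abs_continuous_onE[OF f \<open>\<epsilon> > 0\<close>])
  show "\<exists>\<delta>>0. \<forall>(n::nat) a b.
        (\<forall>i<n. a i \<le> b i \<and> {a i..b i} \<subseteq> {-T..T}) \<longrightarrow>
        (\<forall>i<n. \<forall>j<n. i \<noteq> j \<longrightarrow> {a i<..<b i} \<inter> {a j<..<b j} = {}) \<longrightarrow>
        (\<Sum>i<n. b i - a i) < \<delta>
        \<longrightarrow> (\<Sum>i<n. \<bar>f (- b i) - f (- a i)\<bar>) < \<epsilon>"
  proof (intro exI[of _ \<delta>] conjI allI impI)
    show "\<delta> > 0" by fact
    fix n :: nat and a b
    assume fam: "\<forall>i<n. a i \<le> b i \<and> {a i..b i} \<subseteq> {-T..T}"
        "\<forall>i<n. \<forall>j<n. i \<noteq> j \<longrightarrow> {a i<..<b i} \<inter> {a j<..<b j} = {}"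
        "(\<Sum>i<n. b i - a i) < \<delta>"
    have "(\<Sum>i<n. \<bar>f (- a i) - f (- b i)\<bar>) < \<epsilon>"
    proof (rule \<delta>[rule_format])
      show "- b i \<le> - a i \<and> {- b i..- a i} \<subseteq> {- T..T}" if "i < n" for i
        using fam(1) that by force
      show "{- b i<..<- a i} \<inter> {- b j<..<- a j} = {}" if "i < n" "j < n" "i \<noteq> j" for i j
      proof -
        have "{a i<..<b i} \<inter> {a j<..<b j} = {}" using fam(2) that by blast
        moreover have "- x \<in> {a i<..<b i} \<inter> {a j<..<b j}"
          if "x \<in> {- b i<..<- a i} \<inter> {- b j<..<- a j}" for x
          using that by auto
        ultimately show ?thesis by blast
      qed
    qed (use fam(3) in simp)
    then show "(\<Sum>i<n. \<bar>f (- b i) - f (- a i)\<bar>) < \<epsilon>"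
      by (simp add: abs_minus_commute)
  qed
qed

lemma abs_continuous_on_subset:
  assumes f: "abs_continuous_on S f" and "R \<subseteq> S"
  shows "abs_continuous_on R f"
proof (rule abs_continuous_onI)
  fix \<epsilon> :: real assume "\<epsilon> > 0"
  obtain \<delta> where "\<delta> > 0" and \<delta>: "\<forall>(n::nat) a b. (\<forall>i<n. a i \<le> b i \<and> {a i..b i} \<subseteq> S) \<longrightarrow>
        (\<forall>i<n. \<forall>j<n. i \<noteq> j \<longrightarrow> {a i<..<b i} \<inter> {a j<..<b j} = {}) \<longrightarrow>
        (\<Sum>i<n. b i - a i) < \<delta> \<longrightarrow> (\<Sum>i<n. \<bar>f (b i) - f (a i)\<bar>) < \<epsilon>"
    by (rule abs_continuous_onE[OF f \<open>\<epsilon> > 0\<close>])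
  show "\<exists>\<delta>>0. \<forall>(n::nat) a b.
        (\<forall>i<n. a i \<le> b i \<and> {a i..b i} \<subseteq> R) \<longrightarrow>
        (\<forall>i<n. \<forall>j<n. i \<noteq> j \<longrightarrow> {a i<..<b i} \<inter> {a j<..<b j} = {}) \<longrightarrow>
        (\<Sum>i<n. b i - a i) < \<delta> \<longrightarrow> (\<Sum>i<n. \<bar>f (b i) - f (a i)\<bar>) < \<epsilon>"
  proof (intro exI[of _ \<delta>] conjI allI impI)
    fix n :: nat and a b
    assume "\<forall>i<n. a i \<le> b i \<and> {a i..b i} \<subseteq> R"
      and *: "\<forall>i<n. \<forall>j<n. i \<noteq> j \<longrightarrow> {a i<..<b i} \<inter> {a j<..<b j} = {}"
        "(\<Sum>i<n. b i - a i) < \<delta>"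
    then have "\<forall>i<n. a i \<le> b i \<and> {a i..b i} \<subseteq> S" using \<open>R \<subseteq> S\<close> by (meson order_trans)
    then show "(\<Sum>i<n. \<bar>f (b i) - f (a i)\<bar>) < \<epsilon>" using \<delta> * by blast
  qed (rule \<open>\<delta> > 0\<close>)
qed

lemma abs_cos_diff_le: "\<bar>cos x - cos y\<bar> \<le> \<bar>x - y :: real\<bar>"
proof -
  have "\<bar>cos x - cos y\<bar> = 2 * \<bar>sin ((x + y) / 2)\<bar> * \<bar>sin ((y - x) / 2)\<bar>"
    by (simp add: cos_diff_cos abs_mult)
  also have "\<dots> \<le> 2 * 1 * \<bar>(y - x) / 2\<bar>"
    by (intro mult_mono abs_sin_x_le_abs_x) auto
  finally show ?thesis by simp
qed

lemma abs_sin_diff_le: "\<bar>sin x - sin y\<bar> \<le> \<bar>x - y :: real\<bar>"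
  using abs_cos_diff_le[of "pi / 2 - x" "pi / 2 - y"] by (simp add: cos_diff abs_minus_commute)

lemma abs_continuous_on_trig:
  assumes "K \<ge> 0" "\<And>x y. \<bar>g y - g x\<bar> \<le> K * \<bar>y - x\<bar>"
  shows "abs_continuous_on S (\<lambda>t. cos (g t))" "abs_continuous_on S (\<lambda>t. sin (g t))"
  using order_trans[OF abs_cos_diff_le assms(2)] order_trans[OF abs_sin_diff_le assms(2)]
  by (intro abs_continuous_on_lipschitz[OF assms(1)]; simp)+

lemma abs_continuous_on_trig_shift:
  "abs_continuous_on S (\<lambda>t. cos (m * (T - t)))" "abs_continuous_on S (\<lambda>t. sin (m * (T - t)))"
  "abs_continuous_on S (\<lambda>t. cos (m * (T + t)))" "abs_continuous_on S (\<lambda>t. sin (m * (T + t)))"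
proof -
  have "m * (T - y) - m * (T - x) = m * (x - y)" "m * (T + y) - m * (T + x) = m * (y - x)" for x y
    by (simp_all add: algebra_simps)
  then have "\<bar>m * (T - y) - m * (T - x)\<bar> = \<bar>m\<bar> * \<bar>y - x\<bar>"
    "\<bar>m * (T + y) - m * (T + x)\<bar> = \<bar>m\<bar> * \<bar>y - x\<bar>" for x y
    by (simp_all add: abs_mult abs_minus_commute)
  then show "abs_continuous_on S (\<lambda>t. cos (m * (T - t)))" "abs_continuous_on S (\<lambda>t. sin (m * (T - t)))"
    "abs_continuous_on S (\<lambda>t. cos (m * (T + t)))" "abs_continuous_on S (\<lambda>t. sin (m * (T + t)))"
    by (intro abs_continuous_on_trig[of "\<bar>m\<bar>"]; simp)+
qed


section \<open>The fundamental theorem of calculus for the Lebesgue integral\<close>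

text \<open>Split \<open>\<bar>f\<bar>\<close> at a level \<open>n\<close>: the part above the level has integral less than \<open>\<epsilon> / 2\<close> for large \<open>n\<close>, by
  dominated convergence, and the part below contributes at most \<open>n\<close> times the measure of the set.\<close>

lemma set_integral_absolute_continuity:
  fixes f :: "real \<Rightarrow> real"
  assumes f: "f absolutely_integrable_on S" and "\<epsilon> > 0"
  obtains \<delta> where "\<delta> > 0"
    "\<And>A. \<lbrakk>A \<in> lmeasurable; A \<subseteq> S; measure lebesgue A < \<delta>\<rbrakk> \<Longrightarrow> (LINT x:A|lebesgue. \<bar>f x\<bar>) < \<epsilon>"
proof -
  define g where "g x = \<bar>indicator S x *\<^sub>R f x\<bar>" for x
  have g: "integrable lebesgue g"
    unfolding g_def using f unfolding set_integrable_def by (rule integrable_abs)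
  define tail where "tail n x = (if g x \<le> real n then 0 else g x)" for n x
  have tail_meas: "tail n \<in> borel_measurable lebesgue" for n
    unfolding tail_def using borel_measurable_integrable[OF g] by measurable
  have "(\<lambda>n. integral\<^sup>L lebesgue (tail n)) \<longlonglongrightarrow> integral\<^sup>L lebesgue (\<lambda>x::real. 0::real)"
  proof (rule integral_dominated_convergence[where w = g])
    show "AE x in lebesgue. (\<lambda>n. tail n x) \<longlonglongrightarrow> 0"
    proof (rule AE_I2)
      fix x
      obtain N where "g x \<le> real N" using real_arch_simple by blast
      then have "\<forall>\<^sub>F n in sequentially. tail n x = 0"
        by (intro eventually_sequentiallyI[of N]) (auto simp: tail_def)
      then show "(\<lambda>n. tail n x) \<longlonglongrightarrow> 0" by (rule tendsto_eventually)
    qed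
    show "AE x in lebesgue. norm (tail n x) \<le> g x" for n
      by (rule AE_I2) (auto simp: tail_def g_def)
  qed (use g tail_meas in auto)
  then have "\<forall>\<^sub>F n in sequentially. integral\<^sup>L lebesgue (tail n) < \<epsilon> / 2"
    using \<open>\<epsilon> > 0\<close> by (intro order_tendstoD(2)) auto
  then obtain n where n: "(LINT x|lebesgue. tail n x) < \<epsilon> / 2"
    by (auto simp: eventually_sequentially)
  have tail: "integrable lebesgue (tail n)"
    by (rule Bochner_Integration.integrable_bound[OF g tail_meas]) (auto simp: tail_def g_def)
  show thesis
  proof (rule that)
    show "\<epsilon> / (2 * (real n + 1)) > 0" using \<open>\<epsilon> > 0\<close> by simp
    fix A :: "real set"
    assume A: "A \<in> lmeasurable" "A \<subseteq> S" "measure lebesgue A < \<epsilon> / (2 * (real n + 1))"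
    have "(LINT x:A|lebesgue. \<bar>f x\<bar>) = (LINT x|lebesgue. indicator A x * g x)"
      unfolding set_lebesgue_integral_def using A(2)
      by (intro Bochner_Integration.integral_cong) (auto simp: g_def indicator_def)
    also have "\<dots> \<le> (LINT x|lebesgue. real n * indicator A x + tail n x)"
    proof (rule integral_mono)
      show "integrable lebesgue (\<lambda>x. indicator A x * g x)"
        using A(1) by (intro Bochner_Integration.integrable_bound[OF g])
          (auto simp: g_def indicator_def intro!: borel_measurable_times borel_measurable_indicator
            borel_measurable_integrable[OF g, unfolded g_def, simplified])
      show "integrable lebesgue (\<lambda>x. real n * indicator A x + tail n x)"
        using A(1) tail by (auto simp: fmeasurable_def)
      show "indicator A x * g x \<le> real n * indicator A x + tail n x" for x
        by (auto simp: tail_def indicator_def g_def)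
    qed
    also have "\<dots> = real n * measure lebesgue A + (LINT x|lebesgue. tail n x)"
      using A(1) tail by (auto simp: fmeasurable_def)
    also have "real n * measure lebesgue A \<le> real n * (\<epsilon> / (2 * (real n + 1)))"
      using A(3) by (intro mult_left_mono) auto
    also have "\<dots> \<le> \<epsilon> / 2"
      using \<open>\<epsilon> > 0\<close> by (simp add: field_simps)
    finally show "(LINT x:A|lebesgue. \<bar>f x\<bar>) < \<epsilon>" using n by simp
  qed
qed

text \<open>The increments over disjoint intervals add up to at most the integral of \<open>\<bar>f\<bar>\<close> over their union.\<close>

lemma abs_continuous_on_indefinite_integral:
  fixes f :: "real \<Rightarrow> real"
  assumes f: "f absolutely_integrable_on {c..d}"
  shows "abs_continuous_on {c..d} (\<lambda>x. integral {c..x} f)"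
proof (rule abs_continuous_onI)
  fix \<epsilon> :: real assume "\<epsilon> > 0"
  obtain \<delta> where "\<delta> > 0" and \<delta>: "\<And>A. \<lbrakk>A \<in> lmeasurable; A \<subseteq> {c..d}; measure lebesgue A < \<delta>\<rbrakk>
      \<Longrightarrow> (LINT x:A|lebesgue. \<bar>f x\<bar>) < \<epsilon>"
    using set_integral_absolute_continuity[OF f \<open>\<epsilon> > 0\<close>] by metis
  show "\<exists>\<delta>>0. \<forall>(n::nat) a b.
        (\<forall>i<n. a i \<le> b i \<and> {a i..b i} \<subseteq> {c..d}) \<longrightarrow>
        (\<forall>i<n. \<forall>j<n. i \<noteq> j \<longrightarrow> {a i<..<b i} \<inter> {a j<..<b j} = {}) \<longrightarrow>
        (\<Sum>i<n. b i - a i) < \<delta> \<longrightarrow>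
        (\<Sum>i<n. \<bar>integral {c..b i} f - integral {c..a i} f\<bar>) < \<epsilon>"
  proof (intro exI[of _ \<delta>] conjI allI impI)
    show "\<delta> > 0" by fact
    fix n :: nat and a b
    assume sub: "\<forall>i<n. a i \<le> b i \<and> {a i..b i} \<subseteq> {c..d}"
      and disj: "\<forall>i<n. \<forall>j<n. i \<noteq> j \<longrightarrow> {a i<..<b i} \<inter> {a j<..<b j} = {}"
      and len: "(\<Sum>i<n. b i - a i) < \<delta>"
    define U where "U = (\<Union>i<n. {a i<..<b i})"
    have fi: "f absolutely_integrable_on {a i<..<b i}" if "i < n" for i
      using sub that by (intro set_integrable_subset[OF f]) auto
    have le: "\<bar>integral {c..b i} f - integral {c..a i} f\<bar> \<le> (LINT x:{a i<..<b i}|lebesgue. \<bar>f x\<bar>)"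
      if "i < n" for i
    proof -
      have ab: "a i \<in> {c..d}" "b i \<in> {c..d}" "a i \<le> b i" using sub that by auto
      have "f integrable_on {c..b i}"
      proof (rule integrable_on_subinterval)
        show "f integrable_on {c..d}" by (rule set_lebesgue_integral_eq_integral(1)[OF f])
      qed (use ab in simp)
      then have "integral {c..b i} f - integral {c..a i} f = integral {a i..b i} f"
        using Henstock_Kurzweil_Integration.integral_combine[of c "a i" "b i" f] ab by simp
      also have "\<dots> = (LINT x:{a i<..<b i}|lebesgue. f x)"
        unfolding set_lebesgue_integral_eq_integral(2)[OF fi[OF that]]
        by (rule integral_open_interval_real)
      finally show ?thesis
        using set_integral_norm_bound[OF fi[OF that]] by simp
    qed
    have "(\<Sum>i<n. \<bar>integral {c..b i} f - integral {c..a i} f\<bar>)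
          \<le> (\<Sum>i<n. LINT x:{a i<..<b i}|lebesgue. \<bar>f x\<bar>)"
      by (intro sum_mono le) auto
    also have "\<dots> = (LINT x:U|lebesgue. \<bar>f x\<bar>)"
      unfolding U_def using disj fi
      by (intro set_integral_finite_Union[symmetric])
         (auto simp: disjoint_family_on_def intro: set_integrable_abs)
    also have "\<dots> < \<epsilon>"
    proof (rule \<delta>)
      show "U \<in> lmeasurable" unfolding U_def by (intro fmeasurable.finite_UN) auto
      show "U \<subseteq> {c..d}"
      proof
        fix x assume "x \<in> U"
        then obtain i where "i < n" "x \<in> {a i..b i}" by (auto simp: U_def)
        then show "x \<in> {c..d}" using sub by blast
      qed
      have "measure lebesgue U \<le> (\<Sum>i<n. measure lebesgue {a i<..<b i})"
        unfolding U_def by (intro measure_UNION_le) auto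
      also have "\<dots> = (\<Sum>i<n. b i - a i)"
        using sub by (intro sum.cong) auto
      finally show "measure lebesgue U < \<delta>" using len by simp
    qed
    finally show "(\<Sum>i<n. \<bar>integral {c..b i} f - integral {c..a i} f\<bar>) < \<epsilon>" .
  qed
qed

text \<open>The fundamental theorem of calculus for absolutely continuous functions, for the gauge integral.
  Replace \<open>f\<close> by 0 on the exceptional set \<open>N\<close> and cover \<open>N\<close> by an open set of small measure. A gauge
  that keeps every interval tagged in \<open>N\<close> inside this open set makes the total increment of \<open>F\<close> over
  these intervals small by absolute continuity; at the other tags the gauge comes from
  differentiability, as for an everywhere differentiable \<open>F\<close>.\<close>

theorem abs_continuous_has_integral:
  fixes F :: "real \<Rightarrow> real"
  assumes F: "abs_continuous_on {c..d} F" and "c \<le> d" and N: "negligible N"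
    and deriv: "\<And>x. x \<in> {c..d} - N \<Longrightarrow> (F has_real_derivative f x) (at x within {c..d})"
  shows "(f has_integral F d - F c) {c..d}"
proof -
  define f0 where "f0 x = (if x \<in> N then 0 else f x)" for x
  have "(f0 has_integral F d - F c) (cbox c d)"
    unfolding has_integral
  proof (intro allI impI)
    fix \<epsilon> :: real assume "\<epsilon> > 0"
    \<comment> \<open>The admissible error per unit length at tags outside \<open>N\<close>; the \<open>+ 1\<close> allows for \<open>c = d\<close>.\<close>
    define \<eta> where "\<eta> = \<epsilon> / 2 / (d - c + 1)"
    have "\<eta> > 0" using \<open>\<epsilon> > 0\<close> \<open>c \<le> d\<close> by (simp add: \<eta>_def)
    have "\<eta> * (d - c) = (\<epsilon> / 2) * ((d - c) / (d - c + 1))" by (simp add: \<eta>_def)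
    also have "\<dots> \<le> (\<epsilon> / 2) * 1"
      using \<open>\<epsilon> > 0\<close> \<open>c \<le> d\<close> by (intro mult_left_mono) (auto simp: divide_simps)
    finally have \<eta>: "\<eta> * (d - c) \<le> \<epsilon> / 2" by simp
    obtain \<delta> where "\<delta> > 0"
      and \<delta>: "\<forall>(n::nat) a b. (\<forall>i<n. a i \<le> b i \<and> {a i..b i} \<subseteq> {c..d}) \<longrightarrow>
        (\<forall>i<n. \<forall>j<n. i \<noteq> j \<longrightarrow> {a i<..<b i} \<inter> {a j<..<b j} = {}) \<longrightarrow>
        (\<Sum>i<n. b i - a i) < \<delta> \<longrightarrow> (\<Sum>i<n. \<bar>F (b i) - F (a i)\<bar>) < \<epsilon> / 2"
      by (rule abs_continuous_onE[OF F half_gt_zero[OF \<open>\<epsilon> > 0\<close>]])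
    obtain U where U: "open U" "N \<subseteq> U" "U - N \<in> lmeasurable" "emeasure lebesgue (U - N) < ennreal \<delta>"
      using sets_lebesgue_outer_open[OF negligible_imp_sets[OF N] \<open>\<delta> > 0\<close>] by metis
    have U_meas: "U \<in> lmeasurable" "measure lebesgue U < \<delta>"
    proof -
      have "(U - N) \<union> N \<in> lmeasurable"
        using U(3) N by (intro fmeasurable.Un) (auto intro: negligible_imp_measurable)
      then show "U \<in> lmeasurable" using U(2) by (simp add: Un_absorb2)
      have "measure lebesgue (U - N) = measure lebesgue U"
        using N by (intro measure_Diff_null_set) (auto simp: negligible_iff_null_sets \<open>U \<in> lmeasurable\<close> fmeasurableD)
      moreover have "measure lebesgue (U - N) < \<delta>"
        using U(4) U(3) \<open>\<delta> > 0\<close> by (simp add: emeasure_eq_measure2 ennreal_less_iff)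
      ultimately show "measure lebesgue U < \<delta>" by simp
    qed
    have "\<exists>r>0. (x \<in> N \<longrightarrow> ball x r \<subseteq> U) \<and> (x \<in> {c..d} - N \<longrightarrow>
             (\<forall>y\<in>{c..d}. \<bar>y - x\<bar> < r \<longrightarrow> \<bar>F y - F x - f x * (y - x)\<bar> \<le> \<eta> * \<bar>y - x\<bar>))" for x
    proof (cases "x \<in> N")
      case True
      then show ?thesis using U(1,2) open_contains_ball by auto
    next
      case False
      show ?thesis
      proof (cases "x \<in> {c..d}")
        case True
        then have "(F has_derivative (*) (f x)) (at x within {c..d})"
          using False deriv[of x] by (simp add: has_field_derivative_def)
        then have "\<exists>r>0. \<forall>y\<in>{c..d}. norm (y - x) < r \<longrightarrow>
            norm (F y - F x - f x * (y - x)) \<le> \<eta> * norm (y - x)"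
          using \<open>\<eta> > 0\<close> unfolding has_derivative_within_alt by blast
        with False show ?thesis by auto
      qed (use False in \<open>auto intro: exI[of _ 1]\<close>)
    qed
    then have "\<forall>x. \<exists>r. r>0 \<and> (x \<in> N \<longrightarrow> ball x r \<subseteq> U) \<and> (x \<in> {c..d} - N \<longrightarrow>
             (\<forall>y\<in>{c..d}. \<bar>y - x\<bar> < r \<longrightarrow> \<bar>F y - F x - f x * (y - x)\<bar> \<le> \<eta> * \<bar>y - x\<bar>))"
      by (intro allI)
    from choice[OF this]
    obtain r where r: "\<And>x. r x > 0" "\<And>x. x \<in> N \<Longrightarrow> ball x (r x) \<subseteq> U"
      "\<And>x y. \<lbrakk>x \<in> {c..d} - N; y \<in> {c..d}; \<bar>y - x\<bar> < r x\<rbrakk>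
             \<Longrightarrow> \<bar>F y - F x - f x * (y - x)\<bar> \<le> \<eta> * \<bar>y - x\<bar>"
      by (elim exE) blast
    show "\<exists>\<gamma>. gauge \<gamma> \<and> (\<forall>\<D>. \<D> tagged_division_of cbox c d \<and> \<gamma> fine \<D> \<longrightarrow>
            norm ((\<Sum>(x,K)\<in>\<D>. measure lborel K *\<^sub>R f0 x) - (F d - F c)) < \<epsilon>)"
    proof (intro exI[of _ "\<lambda>x. ball x (r x)"] conjI allI impI; (elim conjE)?)
      show "gauge (\<lambda>x. ball x (r x))" using r(1) by (auto simp: gauge_def)
      fix p assume p: "p tagged_division_of cbox c d" and fine: "(\<lambda>x. ball x (r x)) fine p"
      note p' = tagged_division_ofD[OF p]
      have K: "K = {Inf K..Sup K} \<and> Inf K \<le> x \<and> x \<le> Sup K \<and> c \<le> Inf K \<and> Sup K \<le> d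
               \<and> measure lborel K = Sup K - Inf K \<and> {Inf K..Sup K} \<subseteq> ball x (r x)"
        if xK: "(x, K) \<in> p" for x K
      proof -
        obtain a b where ab: "K = {a..b}" using p'(4)[OF xK] by auto
        moreover have "x \<in> K" "K \<subseteq> {c..d}" using p'(2,3)[OF xK] by auto
        moreover have "K \<subseteq> ball x (r x)" using fine xK by (auto simp: fine_def)
        ultimately show ?thesis by auto
      qed
      \<comment> \<open>\<open>e (x, K)\<close> is the error of one tagged interval, and \<open>pN\<close> collects those with tag in \<open>N\<close>.\<close>
      define e where "e = (\<lambda>(x::real, K). measure lborel K * f0 x - (F (Sup K) - F (Inf K)))"
      define pN where "pN = {q \<in> p. fst q \<in> N}"
      have "finite p" using p'(1) .
      have "(\<Sum>(x,K)\<in>p. measure lborel K *\<^sub>R f0 x) - (F d - F c) = sum e p"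
      proof -
        have "(\<Sum>(x,K)\<in>p. F (Sup K) - F (Inf K)) = F d - F c"
          using additive_tagged_division_1[OF \<open>c \<le> d\<close>, of p F] p by simp
        then show ?thesis unfolding e_def by (simp add: sum_subtractf case_prod_beta)
      qed
      moreover have "\<bar>sum e p\<bar> \<le> (\<Sum>q\<in>pN. \<bar>e q\<bar>) + (\<Sum>q\<in>p - pN. \<bar>e q\<bar>)"
      proof -
        have "sum e p = sum e pN + sum e (p - pN)"
          using \<open>finite p\<close> sum.subset_diff[of pN p e] by (auto simp: pN_def)
        then show ?thesis
          using sum_abs[of e pN] sum_abs[of e "p - pN"] by linarith
      qed
      moreover have "(\<Sum>q\<in>pN. \<bar>e q\<bar>) < \<epsilon> / 2"
      proof -
        have "(\<Sum>q\<in>pN. \<bar>e q\<bar>) = (\<Sum>q\<in>pN. \<bar>F (Sup (snd q)) - F (Inf (snd q))\<bar>)"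
          by (intro sum.cong) (auto simp: e_def pN_def f0_def)
        also have "\<dots> < \<epsilon> / 2"
        proof (rule sum_variation_less_finite_family[OF \<delta>])
          show "finite pN" using \<open>finite p\<close> by (auto simp: pN_def)
          show "Inf (snd q) \<le> Sup (snd q) \<and> {Inf (snd q)..Sup (snd q)} \<subseteq> {c..d}" if "q \<in> pN" for q
          proof -
            have "(fst q, snd q) \<in> p" using that by (simp add: pN_def)
            from K[OF this] show ?thesis unfolding atLeastatMost_subset_iff by linarith
          qed
          show disj: "{Inf (snd q)<..<Sup (snd q)} \<inter> {Inf (snd q')<..<Sup (snd q')} = {}"
            if "q \<in> pN" "q' \<in> pN" "q \<noteq> q'" for q q'
          proof -
            have "interior (snd q) = {Inf (snd q)<..<Sup (snd q)}" if "q \<in> pN" for q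
            proof -
              have "(fst q, snd q) \<in> p" using that by (simp add: pN_def)
              from K[OF this] have "interior (snd q) = interior {Inf (snd q)..Sup (snd q)}" by simp
              then show ?thesis by simp
            qed
            then show ?thesis
              using p'(5)[of "fst q" "snd q" "fst q'" "snd q'"] that by (auto simp: pN_def)
          qed
          have "(\<Sum>q\<in>pN. Sup (snd q) - Inf (snd q))
                = (\<Sum>q\<in>pN. measure lebesgue {Inf (snd q)<..<Sup (snd q)})"
            using K by (intro sum.cong) (force simp: pN_def)+
          also have "\<dots> = measure lebesgue (\<Union>q\<in>pN. {Inf (snd q)<..<Sup (snd q)})"
            using disj \<open>finite pN\<close>
            by (intro measure_negligible_finite_Union_image[symmetric]) (auto simp: pairwise_def)
          also have "\<dots> \<le> measure lebesgue U"
          proof (rule measure_mono_fmeasurable)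
            show "(\<Union>q\<in>pN. {Inf (snd q)<..<Sup (snd q)}) \<subseteq> U"
            proof (rule UN_least)
              fix q assume "q \<in> pN"
              then have "{Inf (snd q)..Sup (snd q)} \<subseteq> ball (fst q) (r (fst q))" "fst q \<in> N"
                using K[of "fst q" "snd q"] by (auto simp: pN_def)
              then show "{Inf (snd q)<..<Sup (snd q)} \<subseteq> U"
                using r(2)[of "fst q"] 
                by (meson greaterThanLessThan_subseteq_atLeastAtMost_iff order_trans order_refl)
            qed
            show "(\<Union>q\<in>pN. {Inf (snd q)<..<Sup (snd q)}) \<in> sets lebesgue"
              using \<open>finite pN\<close> by (intro sets.finite_UN) auto
          qed (rule U_meas(1))
          finally show "(\<Sum>q\<in>pN. Sup (snd q) - Inf (snd q)) < \<delta>" using U_meas(2) by simp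
        qed
        finally show ?thesis .
      qed
      moreover have "(\<Sum>q\<in>p - pN. \<bar>e q\<bar>) \<le> \<epsilon> / 2"
      proof -
        have le: "\<bar>e q\<bar> \<le> \<eta> * measure lborel (snd q)" if "q \<in> p - pN" for q
        proof -
          obtain x K where q: "q = (x, K)" by (cases q)
          with that have xK: "(x, K) \<in> p" "x \<notin> N" by (auto simp: pN_def)
          note k = K[OF xK(1)]
          have *: "\<bar>F y - F x - f x * (y - x)\<bar> \<le> \<eta> * \<bar>y - x\<bar>" if "y \<in> {Inf K, Sup K}" for y
          proof (rule r(3))
            have "Inf K \<le> Sup K" "{Inf K..Sup K} \<subseteq> ball x (r x)" using k by (linarith, blast)
            moreover from this have "y \<in> {Inf K..Sup K}" using that by auto
            ultimately have "y \<in> ball x (r x)" by blast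
            then show "\<bar>y - x\<bar> < r x" by (simp add: dist_real_def abs_minus_commute)
          qed (use k xK that in auto)
          have len: "measure lborel K = Sup K - Inf K"
            and abs: "\<bar>Sup K - x\<bar> = Sup K - x" "\<bar>Inf K - x\<bar> = x - Inf K"
            using k by (blast, linarith+)
          have "e q = - (F (Sup K) - F x - f x * (Sup K - x)) + (F (Inf K) - F x - f x * (Inf K - x))"
            unfolding e_def q prod.case f0_def len using xK(2) by (simp add: algebra_simps)
          also have "\<bar>\<dots>\<bar> \<le> \<eta> * \<bar>Sup K - x\<bar> + \<eta> * \<bar>Inf K - x\<bar>"
            using *[of "Sup K"] *[of "Inf K"] by (simp add: abs_le_iff)
          also have "\<dots> = \<eta> * measure lborel (snd q)"
            unfolding q snd_conv len abs by (simp add: algebra_simps)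
          finally show ?thesis .
        qed
        have "(\<Sum>q\<in>p - pN. \<bar>e q\<bar>) \<le> (\<Sum>q\<in>p - pN. \<eta> * measure lborel (snd q))"
          by (intro sum_mono le)
        also have "\<dots> \<le> (\<Sum>q\<in>p. \<eta> * measure lborel (snd q))"
          using \<open>finite p\<close> \<open>\<eta> > 0\<close> by (intro sum_mono2) auto
        also have "\<dots> = \<eta> * (d - c)"
          using additive_content_tagged_division[OF p] \<open>c \<le> d\<close>
          by (simp add: sum_distrib_left[symmetric] case_prod_beta)
        finally show ?thesis using \<eta> by simp
      qed
      ultimately show "norm ((\<Sum>(x,K)\<in>p. measure lborel K *\<^sub>R f0 x) - (F d - F c)) < \<epsilon>"
        by simp
    qed
  qed
  then show ?thesis
    using has_integral_spike[OF N, of "{c..d}" f f0] by (auto simp: f0_def)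
qed

text \<open>Lebesgue's differentiation theorem in dimension one. If differentiability with derivative \<open>f x\<close>
  fails at \<open>x\<close>, then for some \<open>k\<close> there are arbitrarily short intervals with \<open>x\<close> as an endpoint on
  which the increment of \<open>F\<close> differs from \<open>f x\<close> times the length by more than the \<open>(k + 1)\<close>-th part
  of the length. For fixed \<open>k\<close> these intervals, restricted to those fine for a gauge given by
  Henstock's lemma, form a Vitali cover of the set \<open>E k\<close> of such \<open>x\<close>. Disjoint finite subfamilies
  are tagged partial divisions, so by Henstock's lemma their total length is at most \<open>k + 1\<close> times
  an arbitrarily small number.\<close>

theorem indefinite_integral_has_real_derivative_ae:
  fixes f :: "real \<Rightarrow> real"
  assumes f: "f integrable_on {c..d}"
  shows "negligible {x \<in> {c..d}.
           \<not> ((\<lambda>t. integral {c..t} f) has_real_derivative f x) (at x within {c..d})}"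
proof -
  define F where "F t = integral {c..t} f" for t
  define E where "E k = {x \<in> {c..d}. \<forall>r>0. \<exists>y\<in>{c..d}. \<bar>y - x\<bar> < r \<and>
      \<bar>F y - F x - f x * (y - x)\<bar> > \<bar>y - x\<bar> / (real k + 1)}" for k
  have F_diff: "\<bar>(y - x) * g - (F y - F x)\<bar> =
      \<bar>\<bar>y - x\<bar> * g - integral {min x y..max x y} f\<bar>" if "x \<in> {c..d}" "y \<in> {c..d}" for x y g
  proof -
    have *: "F b - F a = integral {a..b} f" if "a \<in> {c..d}" "b \<in> {c..d}" "a \<le> b" for a b
    proof -
      have "f integrable_on {c..b}"
        by (rule integrable_on_subinterval[OF f]) (use that in simp)
      then show ?thesis
        unfolding F_def
        using Henstock_Kurzweil_Integration.integral_combine[of c a b f] that by simp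
    qed
    show ?thesis
    proof (cases "x \<le> y")
      case True
      then show ?thesis using *[of x y] that by simp
    next
      case False
      then have "F x - F y = integral {min x y..max x y} f" using *[of y x] that by simp
      then show ?thesis using False by (simp add: abs_if algebra_simps)
    qed
  qed
  have "negligible (E k)" for k
    unfolding negligible_outer_le
  proof (intro allI impI)
    fix e :: real assume "e > 0"
    define \<epsilon> where "\<epsilon> = e / (real k + 1)"
    have "\<epsilon> > 0" using \<open>e > 0\<close> by (simp add: \<epsilon>_def)
    have "f integrable_on cbox c d" using f by simp
    from Henstock_lemma[OF this \<open>\<epsilon> > 0\<close>] obtain \<gamma> where "gauge \<gamma>"
      and \<gamma>: "\<And>p. \<lbrakk>p tagged_partial_division_of cbox c d; \<gamma> fine p\<rbrakk> \<Longrightarrow>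
             (\<Sum>(x, K)\<in>p. norm (measure lborel K *\<^sub>R f x - integral K f)) < \<epsilon>"
      by blast
    \<comment> \<open>The covering intervals are indexed by pairs of endpoints \<open>(x, y)\<close>, the first being the tag;
      midpoint and radius present them as balls.\<close>
    define mid :: "real \<times> real \<Rightarrow> real" where "mid = (\<lambda>(x, y). (x + y) / 2)"
    define rad :: "real \<times> real \<Rightarrow> real" where "rad = (\<lambda>(x, y). \<bar>y - x\<bar> / 2)"
    define I where "I = {(x, y). x \<in> E k \<and> y \<in> {c..d} \<and> y \<noteq> x \<and> {min x y..max x y} \<subseteq> \<gamma> x \<and>
        \<bar>y - x\<bar> \<le> (real k + 1) * \<bar>F y - F x - f x * (y - x)\<bar>}"
    have ball_eq: "cball (mid (x, y)) (rad (x, y)) = {min x y..max x y}" for x y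
      by (auto simp: mid_def rad_def cball_eq_atLeastAtMost min_def max_def field_simps abs_if)
    have Ek: "E k \<subseteq> {c..d}" by (auto simp: E_def)
    have "0 < rad i" if "i \<in> I" for i using that by (auto simp: rad_def I_def)
    moreover have "\<exists>i. i \<in> I \<and> x \<in> cball (mid i) (rad i) \<and> rad i < \<rho>" if "x \<in> E k" "\<rho> > 0" for x \<rho>
    proof -
      have "open (\<gamma> x)" "x \<in> \<gamma> x" using \<open>gauge \<gamma>\<close> by (auto simp: gauge_def)
      then obtain \<sigma> where \<sigma>: "\<sigma> > 0" "ball x \<sigma> \<subseteq> \<gamma> x" by (rule openE)
      have "\<forall>r>0. \<exists>y\<in>{c..d}. \<bar>y - x\<bar> < r \<and>
          \<bar>F y - F x - f x * (y - x)\<bar> > \<bar>y - x\<bar> / (real k + 1)"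
        using \<open>x \<in> E k\<close> by (simp add: E_def)
      moreover have "min \<rho> \<sigma> > 0" using \<open>\<rho> > 0\<close> \<open>\<sigma> > 0\<close> by simp
      ultimately obtain y where y: "y \<in> {c..d}" "\<bar>y - x\<bar> < min \<rho> \<sigma>"
        "\<bar>F y - F x - f x * (y - x)\<bar> > \<bar>y - x\<bar> / (real k + 1)"
        by blast
      have "{min x y..max x y} \<subseteq> ball x \<sigma>"
        using y(2) by (auto simp: dist_real_def)
      then have "{min x y..max x y} \<subseteq> \<gamma> x" using \<sigma>(2) by (rule order_trans)
      moreover have "y \<noteq> x" using y(3) by auto
      moreover have "\<bar>y - x\<bar> \<le> (real k + 1) * \<bar>F y - F x - f x * (y - x)\<bar>"
        using y(3) by (simp add: pos_divide_less_eq mult.commute)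
      ultimately have "(x, y) \<in> I"
        using \<open>x \<in> E k\<close> y(1) by (simp add: I_def)
      moreover have "x \<in> cball (mid (x, y)) (rad (x, y))" unfolding ball_eq by simp
      moreover have "rad (x, y) \<le> \<bar>y - x\<bar>" by (simp add: rad_def)
      then have "rad (x, y) < \<rho>" using y(2) by simp
      ultimately show ?thesis by blast
    qed
    ultimately obtain C where C: "countable C" "C \<subseteq> I"
      "pairwise (\<lambda>i j. disjnt (cball (mid i) (rad i)) (cball (mid j) (rad j))) C"
      "negligible (E k - (\<Union>i\<in>C. cball (mid i) (rad i)))"
      by (rule Vitali_covering_theorem_cballs)
    have finite_le: "measure lebesgue (\<Union>i\<in>C'. cball (mid i) (rad i)) \<le> e"
      if C': "C' \<subseteq> C" "finite C'" for C'
    proof -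
      define seg :: "real \<times> real \<Rightarrow> real \<times> real set" where
        "seg = (\<lambda>(x, y). (x, {min x y..max x y}))"
      have I: "i \<in> I" if "i \<in> C'" for i using that C' C(2) by auto
      have disj: "snd (seg i) \<inter> snd (seg j) = {}" if "i \<in> C'" "j \<in> C'" "i \<noteq> j" for i j
      proof -
        have "disjnt (cball (mid i) (rad i)) (cball (mid j) (rad j))"
          using C(3) C'(1) that by (auto simp: pairwise_def)
        moreover have "cball (mid i) (rad i) = snd (seg i)" for i
          using ball_eq by (cases i) (simp add: seg_def)
        ultimately show ?thesis by (simp add: disjnt_def)
      qed
      have ne: "snd (seg i) \<noteq> {}" for i by (cases i) (simp add: seg_def)
      have inj: "inj_on seg C'"
        by (rule inj_onI) (metis disj ne inf.idem)
      have pdiv: "seg ` C' tagged_partial_division_of cbox c d"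
        unfolding tagged_partial_division_of_def
      proof (intro conjI allI impI)
        show "finite (seg ` C')" using C'(2) by simp
      next
        fix x K assume "(x, K) \<in> seg ` C'"
        then obtain y where y: "(x, y) \<in> C'" "K = {min x y..max x y}" by (auto simp: seg_def)
        then have "x \<in> {c..d}" "y \<in> {c..d}" using I[of "(x, y)"] Ek by (auto simp: I_def)
        with y(2) show "x \<in> K" "K \<subseteq> cbox c d" "\<exists>a b. K = cbox a b"
          by (auto simp: min_def max_def intro: exI[of _ "min x y"])
      next
        fix x1 K1 x2 K2
        assume *: "(x1, K1) \<in> seg ` C' \<and> (x2, K2) \<in> seg ` C' \<and> (x1, K1) \<noteq> (x2, K2)"
        then obtain i where i: "i \<in> C'" "(x1, K1) = seg i" by blast
        from * obtain j where j: "j \<in> C'" "(x2, K2) = seg j" by blast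
        have "i \<noteq> j" using * i(2) j(2) by metis
        from disj[OF i(1) j(1) this] have "K1 \<inter> K2 = {}"
          unfolding i(2)[symmetric] j(2)[symmetric] by simp
        then show "interior K1 \<inter> interior K2 = {}"
          using interior_subset by blast
      qed
      have fine: "\<gamma> fine seg ` C'"
        using I by (auto simp: fine_def seg_def I_def)
      have "measure lebesgue (\<Union>i\<in>C'. cball (mid i) (rad i))
            \<le> (\<Sum>i\<in>C'. measure lebesgue (cball (mid i) (rad i)))"
        using C'(2) by (intro measure_UNION_le) auto
      also have "\<dots> = (\<Sum>(x, y)\<in>C'. \<bar>y - x\<bar>)"
        by (intro sum.cong) (auto simp: ball_eq min_def max_def)
      also have "\<dots> \<le> (\<Sum>(x, y)\<in>C'. (real k + 1) * \<bar>F y - F x - f x * (y - x)\<bar>)"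
        using I by (intro sum_mono) (auto simp: I_def)
      also have "\<dots> = (real k + 1) * (\<Sum>(x, y)\<in>C'. \<bar>F y - F x - f x * (y - x)\<bar>)"
        by (simp add: sum_distrib_left case_prod_beta)
      also have "(\<Sum>(x, y)\<in>C'. \<bar>F y - F x - f x * (y - x)\<bar>)
          = (\<Sum>i\<in>C'. (\<lambda>(x, K). norm (measure lborel K *\<^sub>R f x - integral K f)) (seg i))"
      proof (intro sum.cong refl)
        fix i assume "i \<in> C'"
        obtain x y where i: "i = (x, y)" by (cases i)
        with I[OF \<open>i \<in> C'\<close>] Ek have xy: "x \<in> {c..d}" "y \<in> {c..d}" by (auto simp: I_def)
        have "measure lborel {min x y..max x y} = \<bar>y - x\<bar>" by (simp add: min_def max_def)
        then show "(\<lambda>(x, y). \<bar>F y - F x - f x * (y - x)\<bar>) i =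
            (\<lambda>(x, K). norm (measure lborel K *\<^sub>R f x - integral K f)) (seg i)"
          using F_diff[OF xy, of "f x"] by (simp add: i seg_def abs_minus_commute mult.commute)
      qed
      also have "\<dots> = (\<Sum>(x, K)\<in>seg ` C'. norm (measure lborel K *\<^sub>R f x - integral K f))"
        by (simp add: sum.reindex[OF inj])
      also have "\<dots> \<le> \<epsilon>" using \<gamma>[OF pdiv fine] by simp
      also have "(real k + 1) * \<epsilon> = e" by (simp add: \<epsilon>_def)
      finally show ?thesis by simp
    qed
    show "\<exists>T. E k \<subseteq> T \<and> T \<in> lmeasurable \<and> measure lebesgue T \<le> e"
    proof (intro exI conjI)
      let ?V = "\<Union>i\<in>C. cball (mid i) (rad i)" and ?Z = "E k - (\<Union>i\<in>C. cball (mid i) (rad i))"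
      have V: "?V \<in> lmeasurable" "measure lebesgue ?V \<le> e"
        by (rule fmeasurable_UN_bound[OF C(1) _ finite_le] measure_UN_bound[OF C(1) _ finite_le];
            simp)+
      show "E k \<subseteq> ?V \<union> ?Z" by blast
      show "?V \<union> ?Z \<in> lmeasurable"
        by (rule fmeasurable.Un[OF V(1) negligible_imp_measurable[OF C(4)]])
      have "measure lebesgue (?V \<union> ?Z) \<le> measure lebesgue ?V + measure lebesgue ?Z"
        using V(1) C(4) by (intro measure_Un_le) (auto intro: negligible_imp_sets)
      then show "measure lebesgue (?V \<union> ?Z) \<le> e"
        using V(2) negligible_imp_measure0[OF C(4)] by linarith
    qed
  qed
  then have "negligible (\<Union>k. E k)" by (intro negligible_Union_nat)
  moreover have "{x \<in> {c..d}. \<not> (F has_real_derivative f x) (at x within {c..d})} \<subseteq> (\<Union>k. E k)"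
  proof clarify
    fix x assume x: "x \<in> {c..d}" and "\<not> (F has_real_derivative f x) (at x within {c..d})"
    then have "\<not> (\<forall>e>0. \<exists>r>0. \<forall>y\<in>{c..d}. norm (y - x) < r \<longrightarrow>
                 norm (F y - F x - f x * (y - x)) \<le> e * norm (y - x))"
      unfolding has_field_derivative_def has_derivative_within_alt
      by (auto intro: bounded_linear_mult_right)
    then obtain e where "e > 0" and e: "\<And>r. r > 0 \<Longrightarrow> \<exists>y\<in>{c..d}. norm (y - x) < r \<and>
                 \<not> norm (F y - F x - f x * (y - x)) \<le> e * norm (y - x)"
      by blast
    obtain k where k: "1 / (real k + 1) < e"
      using \<open>e > 0\<close> nat_approx_posE[of e] by (auto simp: add.commute)
    have "x \<in> E k"
      unfolding E_def
    proof (intro CollectI conjI allI impI x)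
      fix r :: real assume "r > 0"
      from e[OF this] obtain y where y: "y \<in> {c..d}" "\<bar>y - x\<bar> < r"
        "\<bar>F y - F x - f x * (y - x)\<bar> > e * \<bar>y - x\<bar>" by auto
      have "\<bar>y - x\<bar> / (real k + 1) \<le> e * \<bar>y - x\<bar>"
        using mult_right_mono[of "1 / (real k + 1)" e "\<bar>y - x\<bar>"] k by simp
      with y show "\<exists>y\<in>{c..d}. \<bar>y - x\<bar> < r \<and>
          \<bar>F y - F x - f x * (y - x)\<bar> > \<bar>y - x\<bar> / (real k + 1)"
        by (meson le_less_trans)
    qed
    then show "x \<in> (\<Union>k. E k)" by blast
  qed
  ultimately show ?thesis
    unfolding F_def[symmetric] by (rule negligible_subset)
qed

section \<open>Integrals of piecewise trigonometric kernels\<close>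

lemma absolutely_integrable_continuous_mult:
  fixes f :: "real \<Rightarrow> real"
  assumes "continuous_on {a..b} p" "f absolutely_integrable_on {a..b}"
  shows "(\<lambda>s. p s * f s) absolutely_integrable_on {a..b}"
proof (rule absolutely_integrable_bounded_measurable_product_real)
  show "p \<in> borel_measurable (lebesgue_on {a..b})"
    using assms(1) by (intro continuous_imp_measurable_on_sets_lebesgue) auto
  show "bounded (p ` {a..b})"
    using assms(1) by (intro compact_imp_bounded compact_continuous_image) auto
qed (use assms in auto)

definition cos_moment :: "real \<Rightarrow> real \<Rightarrow> (real \<Rightarrow> real) \<Rightarrow> real \<Rightarrow> real" where
  "cos_moment T m f t = integral {-T..t} (\<lambda>s. cos (m * s) * f s)"

definition sin_moment :: "real \<Rightarrow> real \<Rightarrow> (real \<Rightarrow> real) \<Rightarrow> real \<Rightarrow> real" where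
  "sin_moment T m f t = integral {-T..t} (\<lambda>s. sin (m * s) * f s)"

lemma moment_start [simp]: "cos_moment T m f (-T) = 0" "sin_moment T m f (-T) = 0"
  by (simp_all add: cos_moment_def sin_moment_def)

lemma absolutely_integrable_trig_mult:
  fixes f :: "real \<Rightarrow> real"
  assumes "f absolutely_integrable_on {a..b}"
  shows "(\<lambda>s. cos (m * s) * f s) absolutely_integrable_on {a..b}"
    "(\<lambda>s. sin (m * s) * f s) absolutely_integrable_on {a..b}"
  by (intro absolutely_integrable_continuous_mult continuous_intros assms)+

text \<open>The kernels met below are trigonometric polynomials on either side of a corner \<open>c\<close>, a null set,
  where they may jump; splitting the integral at \<open>c\<close> expresses it by the two moments of \<open>f\<close>.\<close>

lemma piecewise_trig_kernel_integral:
  fixes f k :: "real \<Rightarrow> real"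
  assumes f: "f absolutely_integrable_on {-T..T}" and c: "c \<in> {-T..T}"
    and left: "\<And>s. \<lbrakk>s \<in> {-T..T}; s < c\<rbrakk> \<Longrightarrow> k s = p * cos (m * s) + q * sin (m * s)"
    and right: "\<And>s. \<lbrakk>s \<in> {-T..T}; s > c\<rbrakk> \<Longrightarrow> k s = p' * cos (m * s) + q' * sin (m * s)"
  shows "(\<lambda>s. k s * f s) absolutely_integrable_on {-T..T}"
    and "integral {-T..T} (\<lambda>s. k s * f s) =
         p * cos_moment T m f c + q * sin_moment T m f c
         + p' * (cos_moment T m f T - cos_moment T m f c)
         + q' * (sin_moment T m f T - sin_moment T m f c)"
proof -
  have sub: "f absolutely_integrable_on {-T..c}" "f absolutely_integrable_on {c..T}"
    using c by (auto intro: absolutely_integrable_on_subinterval[OF f])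
  have piece: "(\<lambda>s. (p * cos (m * s) + q * sin (m * s)) * f s) absolutely_integrable_on {a..b} \<and>
      ((\<lambda>s. (p * cos (m * s) + q * sin (m * s)) * f s) has_integral
        p * integral {a..b} (\<lambda>s. cos (m * s) * f s) + q * integral {a..b} (\<lambda>s. sin (m * s) * f s)) {a..b}"
    if "f absolutely_integrable_on {a..b}" for p q a b
  proof
    show "(\<lambda>s. (p * cos (m * s) + q * sin (m * s)) * f s) absolutely_integrable_on {a..b}"
      by (intro absolutely_integrable_continuous_mult continuous_intros that)
    have "((\<lambda>s. p * (cos (m * s) * f s) + q * (sin (m * s) * f s)) has_integral
        p * integral {a..b} (\<lambda>s. cos (m * s) * f s) + q * integral {a..b} (\<lambda>s. sin (m * s) * f s)) {a..b}"
      by (intro has_integral_add has_integral_mult_right integrable_integral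
          set_lebesgue_integral_eq_integral(1) absolutely_integrable_trig_mult that)
    then show "((\<lambda>s. (p * cos (m * s) + q * sin (m * s)) * f s) has_integral
        p * integral {a..b} (\<lambda>s. cos (m * s) * f s) + q * integral {a..b} (\<lambda>s. sin (m * s) * f s)) {a..b}"
      by (simp add: algebra_simps)
  qed
  have moment_diff: "integral {c..T} (\<lambda>s. w s * f s) =
      integral {-T..T} (\<lambda>s. w s * f s) - integral {-T..c} (\<lambda>s. w s * f s)"
    if "(\<lambda>s. w s * f s) absolutely_integrable_on {-T..T}" for w
    using Henstock_Kurzweil_Integration.integral_combine[of "-T" c T "\<lambda>s. w s * f s"] c
      set_lebesgue_integral_eq_integral(1)[OF that] by simp
  have L: "(\<lambda>s. k s * f s) absolutely_integrable_on {-T..c}"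
    by (rule absolutely_integrable_spike[OF conjunct1[OF piece[OF sub(1), of p q]], of "{c}"])
      (use left c in auto)
  have R: "(\<lambda>s. k s * f s) absolutely_integrable_on {c..T}"
    by (rule absolutely_integrable_spike[OF conjunct1[OF piece[OF sub(2), of p' q']], of "{c}"])
      (use right c in auto)
  have "{-T..T} = {-T..c} \<union> {c..T}" using c by auto
  then show "(\<lambda>s. k s * f s) absolutely_integrable_on {-T..T}"
    using absolutely_integrable_Un[OF L R] by simp
  have "((\<lambda>s. k s * f s) has_integral
        p * integral {-T..c} (\<lambda>s. cos (m * s) * f s) + q * integral {-T..c} (\<lambda>s. sin (m * s) * f s)) {-T..c}"
    by (rule has_integral_spike[OF _ _ conjunct2[OF piece[OF sub(1)]], of "{c}"]) (use left c in auto)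
  moreover have "((\<lambda>s. k s * f s) has_integral
        p' * integral {c..T} (\<lambda>s. cos (m * s) * f s) + q' * integral {c..T} (\<lambda>s. sin (m * s) * f s)) {c..T}"
    by (rule has_integral_spike[OF _ _ conjunct2[OF piece[OF sub(2)]], of "{c}"]) (use right c in auto)
  ultimately have "((\<lambda>s. k s * f s) has_integral
        (p * integral {-T..c} (\<lambda>s. cos (m * s) * f s) + q * integral {-T..c} (\<lambda>s. sin (m * s) * f s))
      + (p' * integral {c..T} (\<lambda>s. cos (m * s) * f s) + q' * integral {c..T} (\<lambda>s. sin (m * s) * f s))) {-T..T}"
    using c by (intro has_integral_combine[of "-T" c T]) auto
  then show "integral {-T..T} (\<lambda>s. k s * f s) =
         p * cos_moment T m f c + q * sin_moment T m f c
         + p' * (cos_moment T m f T - cos_moment T m f c)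
         + q' * (sin_moment T m f T - sin_moment T m f c)"
    unfolding cos_moment_def sin_moment_def
      moment_diff[OF absolutely_integrable_trig_mult(1)[OF f], symmetric]
      moment_diff[OF absolutely_integrable_trig_mult(2)[OF f], symmetric]
    by (simp add: integral_unique)
qed

lemma has_real_derivative_cong_within:
  fixes f g :: "real \<Rightarrow> real"
  assumes "(f has_real_derivative D) (at t within S)" "t \<in> S" "\<And>x. x \<in> S \<Longrightarrow> f x = g x"
  shows "(g has_real_derivative D) (at t within S)"
  using assms by (intro has_field_derivative_transform_within[OF assms(1), of 1]) auto

text \<open>The first two left-hand sides are the limits of \<open>cos (m (T - \<bar>t - s\<bar>))\<close> as \<open>s\<close> tends to \<open>t\<close> from the left
  and from the right; that they agree removes the integrand from a first derivative. The last two
  are, up to sign, the one-sided limits of \<open>sgn (t - s) sin (m (T - \<bar>t - s\<bar>))\<close>; their sum is the jump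
  that brings the integrand back.\<close>

lemma trig_shift_identities:
  fixes m T t :: real
  shows "cos (m * (T - t)) * cos (m * t) - sin (m * (T - t)) * sin (m * t) = cos (m * T)"
    "cos (m * (T + t)) * cos (m * t) + sin (m * (T + t)) * sin (m * t) = cos (m * T)"
    "sin (m * (T - t)) * cos (m * t) + cos (m * (T - t)) * sin (m * t) = sin (m * T)"
    "sin (m * (T + t)) * cos (m * t) - cos (m * (T + t)) * sin (m * t) = sin (m * T)"
  using cos_add[of "m * (T - t)" "m * t"] cos_diff[of "m * (T + t)" "m * t"]
    sin_add[of "m * (T - t)" "m * t"] sin_diff[of "m * (T + t)" "m * t"]
  by (simp_all add: algebra_simps)

lemma nonresonant:
  fixes T m :: real
  assumes "T > 0" "\<forall>k::int. m \<noteq> of_int k * pi / T"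
  shows "m \<noteq> 0" "sin (m * T) \<noteq> 0"
proof -
  show "m \<noteq> 0" using assms(2)[rule_format, of 0] by simp
  show "sin (m * T) \<noteq> 0"
  proof
    assume "sin (m * T) = 0"
    then obtain k :: int where "m * T = of_int k * pi" by (auto simp: sin_zero_iff_int2)
    then have "m = of_int k * pi / T" using \<open>T > 0\<close> by (simp add: field_simps)
    with assms(2) show False by blast
  qed
qed

section \<open>The periodic second-order problem\<close>

text \<open>The Green's function of the periodic problem in closed form.\<close>

definition periodic_kernel :: "real \<Rightarrow> real \<Rightarrow> real \<Rightarrow> real \<Rightarrow> real" where
  "periodic_kernel T m t s = cos (m * (T - \<bar>t - s\<bar>)) / (2 * m * sin (m * T))"

lemma periodic_kernel_integral:
  assumes f: "f absolutely_integrable_on {-T..T}" and t: "t \<in> {-T..T}"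
  shows "(LINT s:{-T..T}|lebesgue. periodic_kernel T m t s * f s) =
     (cos (m * (T - t)) * cos_moment T m f t - sin (m * (T - t)) * sin_moment T m f t
      + cos (m * (T + t)) * (cos_moment T m f T - cos_moment T m f t)
      + sin (m * (T + t)) * (sin_moment T m f T - sin_moment T m f t)) / (2 * m * sin (m * T))"
proof -
  define D where "D = 2 * m * sin (m * T)"
  have left: "periodic_kernel T m t s
      = cos (m * (T - t)) / D * cos (m * s) + (- sin (m * (T - t)) / D) * sin (m * s)" if "s \<in> {-T..T}" "s < t" for s
  proof -
    have "m * (T - \<bar>t - s\<bar>) = m * (T - t) + m * s" using that by (simp add: algebra_simps)
    then show ?thesis
      unfolding periodic_kernel_def D_def[symmetric] by (simp add: cos_add diff_divide_distrib)
  qed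
  have right: "periodic_kernel T m t s
      = cos (m * (T + t)) / D * cos (m * s) + sin (m * (T + t)) / D * sin (m * s)" if "s \<in> {-T..T}" "t < s" for s
  proof -
    have "m * (T - \<bar>t - s\<bar>) = m * (T + t) - m * s" using that by (simp add: algebra_simps)
    then show ?thesis
      unfolding periodic_kernel_def D_def[symmetric] by (simp add: cos_diff add_divide_distrib)
  qed
  have "(\<lambda>s. periodic_kernel T m t s * f s) absolutely_integrable_on {-T..T}"
    by (rule piecewise_trig_kernel_integral(1)[OF f t left right])
  then have "(LINT s:{-T..T}|lebesgue. periodic_kernel T m t s * f s)
      = integral {-T..T} (\<lambda>s. periodic_kernel T m t s * f s)"
    by (rule set_lebesgue_integral_eq_integral(2))
  also have "\<dots> = cos (m * (T - t)) / D * cos_moment T m f t + (- sin (m * (T - t)) / D) * sin_moment T m f t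
         + cos (m * (T + t)) / D * (cos_moment T m f T - cos_moment T m f t)
         + sin (m * (T + t)) / D * (sin_moment T m f T - sin_moment T m f t)"
    by (rule piecewise_trig_kernel_integral(2)[OF f t left right])
  finally show ?thesis
    unfolding D_def[symmetric] by (simp add: add_divide_distrib diff_divide_distrib)
qed

text \<open>Differentiate the closed form of the integral twice. The first derivatives of the moments cancel
  by continuity of the kernel at \<open>s = t\<close>; in the second step they produce \<open>f\<close>, by the jump of its
  derivative.\<close>

lemma periodic_solution2_kernel:
  assumes "T > 0" and m: "m \<noteq> 0" "sin (m * T) \<noteq> 0" and f: "continuous_on {-T..T} f"
  shows "periodic_solution2 T m f (\<lambda>t. LINT s:{-T..T}|lebesgue. periodic_kernel T m t s * f s)"
proof -
  define C where "C = cos_moment T m f"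
  define S where "S = sin_moment T m f"
  define D where "D = 2 * m * sin (m * T)"
  have D: "D \<noteq> 0" using m by (simp add: D_def)
  have C': "(C has_real_derivative cos (m * t) * f t) (at t within {-T..T})"
    and S': "(S has_real_derivative sin (m * t) * f t) (at t within {-T..T})" if "t \<in> {-T..T}" for t
    unfolding C_def S_def cos_moment_def sin_moment_def
    by (intro integral_has_real_derivative continuous_intros f that)+
  have start: "C (-T) = 0" "S (-T) = 0" by (simp_all add: C_def S_def)
  define v where "v t = cos (m * (T - t)) * C t - sin (m * (T - t)) * S t
      + cos (m * (T + t)) * (C T - C t) + sin (m * (T + t)) * (S T - S t)" for t
  define w where "w t = m * (sin (m * (T - t)) * C t + cos (m * (T - t)) * S t
      - sin (m * (T + t)) * (C T - C t) + cos (m * (T + t)) * (S T - S t))" for t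
  have v': "(v has_real_derivative w t) (at t within {-T..T})" if t: "t \<in> {-T..T}" for t
    unfolding v_def
    apply (rule derivative_eq_intros C'[OF t] S'[OF t] refl)+
    using arg_cong2[OF trig_shift_identities(1,2)[of m T t], of "\<lambda>x y. f t * (x - y)"]
    unfolding w_def by (simp add: algebra_simps)
  have w': "(w has_real_derivative D * f t - m\<^sup>2 * v t) (at t within {-T..T})" if t: "t \<in> {-T..T}" for t
    unfolding w_def
    apply (rule derivative_eq_intros C'[OF t] S'[OF t] refl)+
    using arg_cong2[OF trig_shift_identities(3,4)[of m T t], of "\<lambda>x y. m * f t * (x + y)"]
    unfolding v_def D_def by (simp add: algebra_simps power2_eq_square)
  have u_eq: "v t / D = (LINT s:{-T..T}|lebesgue. periodic_kernel T m t s * f s)" if "t \<in> {-T..T}" for t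
    using periodic_kernel_integral[OF absolutely_integrable_continuous_real[OF f] that, of m]
    unfolding v_def D_def C_def S_def by simp
  show ?thesis
    unfolding periodic_solution2_def
  proof (intro exI[of _ "\<lambda>t. w t / D"] conjI ballI)
    fix t assume t: "t \<in> {-T..T}"
    show "((\<lambda>t. LINT s:{-T..T}|lebesgue. periodic_kernel T m t s * f s)
        has_real_derivative w t / D) (at t within {-T..T})"
      by (rule has_real_derivative_cong_within[OF DERIV_cdivide[OF v'[OF t]] t u_eq])
    have "((\<lambda>t. w t / D) has_real_derivative (D * f t - m\<^sup>2 * v t) / D) (at t within {-T..T})"
      by (rule DERIV_cdivide[OF w'[OF t]])
    also have "(D * f t - m\<^sup>2 * v t) / D = f t - m\<^sup>2 * (v t / D)"
      using D by (simp add: field_simps)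
    finally show "((\<lambda>t. w t / D) has_real_derivative f t
        - m\<^sup>2 * (LINT s:{-T..T}|lebesgue. periodic_kernel T m t s * f s)) (at t within {-T..T})"
      unfolding u_eq[OF t] .
  next
    have T: "T \<in> {-T..T}" "-T \<in> {-T..T}" using \<open>T > 0\<close> by auto
    show "(LINT s:{-T..T}|lebesgue. periodic_kernel T m T s * f s)
        - (LINT s:{-T..T}|lebesgue. periodic_kernel T m (-T) s * f s) = 0"
      unfolding u_eq[OF T(1), symmetric] u_eq[OF T(2), symmetric] by (simp add: v_def start)
    show "w T / D - w (-T) / D = 0" by (simp add: w_def start)
  qed
qed

text \<open>The phase-plane vector \<open>(m y, y')\<close> rotates with angular speed \<open>\<bar>m\<bar>\<close>, so its coordinates \<open>a\<close>, \<open>b\<close>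
  in the rotating frame are constant. Comparing them at \<open>T\<close> and \<open>-T\<close>, where the vector itself has the
  same value, forces that vector to be zero because \<open>sin (m T) \<noteq> 0\<close>.\<close>

lemma periodic_solution2_zero_unique:
  assumes "T > 0" and m: "m \<noteq> 0" "sin (m * T) \<noteq> 0"
    and y: "periodic_solution2 T m (\<lambda>_. 0) y" and t: "t \<in> {-T..T}"
  shows "y t = 0"
proof -
  obtain y' where y1: "\<And>t. t \<in> {-T..T} \<Longrightarrow> (y has_real_derivative y' t) (at t within {-T..T})"
    and y2: "\<And>t. t \<in> {-T..T} \<Longrightarrow> (y' has_real_derivative 0 - m\<^sup>2 * y t) (at t within {-T..T})"
    and bc: "y T - y (-T) = 0" "y' T - y' (-T) = 0"
    using y unfolding periodic_solution2_def by blast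
  define a where "a t = m * y t * cos (m * t) - y' t * sin (m * t)" for t
  define b where "b t = m * y t * sin (m * t) + y' t * cos (m * t)" for t
  have T: "T \<in> {-T..T}" "-T \<in> {-T..T}" using \<open>T > 0\<close> by auto
  have "(a has_real_derivative 0) (at t within {-T..T})" if "t \<in> {-T..T}" for t
    unfolding a_def
    by (rule derivative_eq_intros y1[OF that] y2[OF that] refl)+
      (simp add: algebra_simps power2_eq_square)
  from has_field_derivative_zero_constant[OF _ this] obtain ca where a: "\<And>t. t \<in> {-T..T} \<Longrightarrow> a t = ca"
    by auto
  have "(b has_real_derivative 0) (at t within {-T..T})" if "t \<in> {-T..T}" for t
    unfolding b_def
    by (rule derivative_eq_intros y1[OF that] y2[OF that] refl)+
      (simp add: algebra_simps power2_eq_square)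
  from has_field_derivative_zero_constant[OF _ this] obtain cb where b: "\<And>t. t \<in> {-T..T} \<Longrightarrow> b t = cb"
    by auto
  have "a T = a (-T)" "b T = b (-T)" using a b T by simp_all
  then have "y' T * sin (m * T) = 0" "m * y T * sin (m * T) = 0"
    using bc by (simp_all add: a_def b_def)
  then have "y' T = 0" "y T = 0" using m by auto
  then have "a T = 0" "b T = 0" by (simp_all add: a_def b_def)
  then have "a t = 0" "b t = 0" using a[OF t] a[OF T(1)] b[OF t] b[OF T(1)] by auto
  then have "m * y t * (cos (m * t) * cos (m * t) + sin (m * t) * sin (m * t)) = 0"
    unfolding a_def b_def by algebra
  then show "y t = 0" using m(1) by (simp add: power2_eq_square[symmetric])
qed

lemma periodic_solution2_unique:
  assumes "T > 0" "m \<noteq> 0" "sin (m * T) \<noteq> 0"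
    and x: "periodic_solution2 T m f x" and y: "periodic_solution2 T m f y" and t: "t \<in> {-T..T}"
  shows "x t = y t"
proof -
  have "periodic_solution2 T m (\<lambda>_. 0) (\<lambda>t. x t - y t)"
  proof -
    obtain x' y' where
      x': "\<And>t. t \<in> {-T..T} \<Longrightarrow> (x has_real_derivative x' t) (at t within {-T..T})"
        "\<And>t. t \<in> {-T..T} \<Longrightarrow> (x' has_real_derivative f t - m\<^sup>2 * x t) (at t within {-T..T})"
        "x T - x (-T) = 0" "x' T - x' (-T) = 0" and
      y': "\<And>t. t \<in> {-T..T} \<Longrightarrow> (y has_real_derivative y' t) (at t within {-T..T})"
        "\<And>t. t \<in> {-T..T} \<Longrightarrow> (y' has_real_derivative f t - m\<^sup>2 * y t) (at t within {-T..T})"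
        "y T - y (-T) = 0" "y' T - y' (-T) = 0"
      using x y unfolding periodic_solution2_def by blast
    show ?thesis
      unfolding periodic_solution2_def
    proof (intro exI[of _ "\<lambda>t. x' t - y' t"] conjI ballI)
      fix t assume "t \<in> {-T..T}"
      then show "((\<lambda>t. x t - y t) has_real_derivative x' t - y' t) (at t within {-T..T})"
        by (intro DERIV_diff x' y')
      have "((\<lambda>t. x' t - y' t) has_real_derivative (f t - m\<^sup>2 * x t) - (f t - m\<^sup>2 * y t)) (at t within {-T..T})"
        using \<open>t \<in> {-T..T}\<close> by (intro DERIV_diff x' y')
      then show "((\<lambda>t. x' t - y' t) has_real_derivative 0 - m\<^sup>2 * (x t - y t)) (at t within {-T..T})"
        by (simp add: algebra_simps)
    qed (use x' y' in auto)
  qed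
  from periodic_solution2_zero_unique[OF assms(1-3) this t] show ?thesis by simp
qed

text \<open>\<open>G\<close> may differ from the closed form off the square, as the extension by 0 does.\<close>

lemma is_green_function_kernel:
  assumes "T > 0" and m: "m \<noteq> 0" "sin (m * T) \<noteq> 0"
    and G: "\<And>t s. \<lbrakk>t \<in> {-T..T}; s \<in> {-T..T}\<rbrakk> \<Longrightarrow> G t s = periodic_kernel T m t s"
  shows "is_green_function T m G"
  unfolding is_green_function_def Let_def
proof (intro conjI allI impI ballI)
  have "continuous_on ({-T..T} \<times> {-T..T}) (\<lambda>(t, s). periodic_kernel T m t s)"
    unfolding periodic_kernel_def case_prod_beta using m by (intro continuous_intros) auto
  then show "continuous_on ({-T..T} \<times> {-T..T}) (\<lambda>(t, s). G t s)"
    by (rule continuous_on_eq) (use G in auto)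
  fix f :: "real \<Rightarrow> real" assume f: "continuous_on {-T..T} f"
  have eq: "(LINT s:{-T..T}|lebesgue. G t s * f s)
      = (LINT s:{-T..T}|lebesgue. periodic_kernel T m t s * f s)" if "t \<in> {-T..T}" for t
    by (intro set_lebesgue_integral_cong) (use G that in auto)
  have sol: "periodic_solution2 T m f (\<lambda>t. LINT s:{-T..T}|lebesgue. periodic_kernel T m t s * f s)"
    by (rule periodic_solution2_kernel[OF assms(1-3) f])
  have T: "T \<in> {-T..T}" "-T \<in> {-T..T}" using \<open>T > 0\<close> by auto
  show sol': "periodic_solution2 T m f (\<lambda>t. LINT s:{-T..T}|lebesgue. G t s * f s)"
  proof -
    obtain x' where x': "\<And>t. t \<in> {-T..T} \<Longrightarrow>
          ((\<lambda>t. LINT s:{-T..T}|lebesgue. periodic_kernel T m t s * f s) has_real_derivative x' t) (at t within {-T..T})"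
        "\<And>t. t \<in> {-T..T} \<Longrightarrow> (x' has_real_derivative
          f t - m\<^sup>2 * (LINT s:{-T..T}|lebesgue. periodic_kernel T m t s * f s)) (at t within {-T..T})"
        "(LINT s:{-T..T}|lebesgue. periodic_kernel T m T s * f s)
          - (LINT s:{-T..T}|lebesgue. periodic_kernel T m (-T) s * f s) = 0"
        "x' T - x' (-T) = 0"
      using sol unfolding periodic_solution2_def by blast
    show ?thesis
      unfolding periodic_solution2_def
    proof (intro exI[of _ x'] conjI ballI)
      fix t assume t: "t \<in> {-T..T}"
      show "((\<lambda>t. LINT s:{-T..T}|lebesgue. G t s * f s) has_real_derivative x' t) (at t within {-T..T})"
        by (rule has_real_derivative_cong_within[OF x'(1)[OF t] t eq[symmetric]])
      show "(x' has_real_derivative f t - m\<^sup>2 * (LINT s:{-T..T}|lebesgue. G t s * f s)) (at t within {-T..T})"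
        unfolding eq[OF t] by (rule x'(2)[OF t])
    next
      show "(LINT s:{-T..T}|lebesgue. G T s * f s) - (LINT s:{-T..T}|lebesgue. G (-T) s * f s) = 0"
        unfolding eq[OF T(1)] eq[OF T(2)] by (rule x'(3))
    qed (rule x'(4))
  qed
  fix x t assume "periodic_solution2 T m f x" "t \<in> {-T..T}"
  then show "x t = (LINT s:{-T..T}|lebesgue. G t s * f s)"
    using periodic_solution2_unique[OF assms(1-3) _ sol'] by blast
qed

text \<open>Test both kernels against the continuous function \<open>f = G t - H t\<close>: the two solutions coincide at \<open>t\<close>,
  so the integral of \<open>(G t - H t)\<^sup>2\<close> vanishes.\<close>

lemma is_green_function_unique:
  assumes "T > 0" and G: "is_green_function T m G" and H: "is_green_function T m H"
    and t: "t \<in> {-T..T}" and s: "s \<in> {-T..T}"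
  shows "G t s = H t s"
proof -
  have cont: "continuous_on {-T..T} (\<lambda>s. K t s)" if "is_green_function T m K" for K
  proof -
    have "continuous_on ({-T..T} \<times> {-T..T}) (\<lambda>(t, s). K t s)"
      using that by (simp add: is_green_function_def)
    moreover have "continuous_on {-T..T} (\<lambda>s. (t, s))"
      by (rule continuous_on_Pair[OF continuous_on_const continuous_on_id])
    moreover have "(\<lambda>s. (t, s)) ` {-T..T} \<subseteq> {-T..T} \<times> {-T..T}" using t by auto
    ultimately have "continuous_on {-T..T} (\<lambda>s. (\<lambda>(t, s). K t s) (t, s))"
      by (rule continuous_on_compose2)
    then show ?thesis by simp
  qed
  define d where "d s = G t s - H t s" for s
  have d: "continuous_on {-T..T} d"
    unfolding d_def by (intro continuous_intros cont G H)
  have eq: "(LINT s:{-T..T}|lebesgue. G t s * d s) = (LINT s:{-T..T}|lebesgue. H t s * d s)"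
    using G H d t unfolding is_green_function_def Let_def by blast
  have int: "(\<lambda>s. K t s * d s) absolutely_integrable_on {-T..T}" if "is_green_function T m K" for K
    by (intro absolutely_integrable_continuous_real continuous_intros cont d that)
  have "integral {-T..T} (\<lambda>s. (d s)\<^sup>2) = integral {-T..T} (\<lambda>s. G t s * d s - H t s * d s)"
    by (simp add: d_def power2_eq_square algebra_simps)
  also have "\<dots> = integral {-T..T} (\<lambda>s. G t s * d s) - integral {-T..T} (\<lambda>s. H t s * d s)"
    by (intro integral_diff set_lebesgue_integral_eq_integral(1) int G H)
  also have "\<dots> = 0"
    using eq by (simp add: set_lebesgue_integral_eq_integral(2)[OF int] G H)
  finally have "integral {-T..T} (\<lambda>s. (d s)\<^sup>2) = 0" .
  moreover have "continuous_on {-T..T} (\<lambda>s. (d s)\<^sup>2)" by (intro continuous_intros d)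
  ultimately have "(d s)\<^sup>2 = 0"
    using integral_eq_0_iff[of "-T" T "\<lambda>s. (d s)\<^sup>2"] \<open>T > 0\<close> s by auto
  then show ?thesis by (simp add: d_def)
qed

lemma green_function_eq_kernel:
  assumes "T > 0" and m: "m \<noteq> 0" "sin (m * T) \<noteq> 0" and "t \<in> {-T..T}" "s \<in> {-T..T}"
  shows "green_function T m t s = periodic_kernel T m t s"
proof -
  define K where "K t s = (if (t, s) \<in> {-T..T} \<times> {-T..T} then periodic_kernel T m t s else 0)" for t s
  have K: "is_green_function T m K"
    by (rule is_green_function_kernel[OF assms(1-3)]) (simp add: K_def)
  have "green_function T m = K"
    unfolding green_function_def
  proof (rule the_equality)
    show "is_green_function T m K \<and> (\<forall>t s. (t, s) \<notin> {-T..T} \<times> {-T..T} \<longrightarrow> K t s = 0)"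
      using K by (auto simp: K_def)
    fix G assume G: "is_green_function T m G \<and> (\<forall>t s. (t, s) \<notin> {-T..T} \<times> {-T..T} \<longrightarrow> G t s = 0)"
    show "G = K"
    proof (intro ext)
      fix t s
      show "G t s = K t s"
      proof (cases "(t, s) \<in> {-T..T} \<times> {-T..T}")
        case True
        then show ?thesis using is_green_function_unique[OF \<open>T > 0\<close> _ K, of G t s] G by auto
      next
        case False
        then have "G t s = 0" using G by blast
        moreover have "K t s = 0" using False by (simp only: K_def if_False)
        ultimately show ?thesis by simp
      qed
    qed
  qed
  then show ?thesis using assms by (simp add: K_def)
qed

section \<open>The first-order problem with reflection\<close>

lemma green_function_has_real_derivative:
  assumes "T > 0" and m: "m \<noteq> 0" "sin (m * T) \<noteq> 0"
    and t: "t \<in> {-T..T}" and s: "s \<in> {-T..T}" and "s \<noteq> t"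
  shows "((\<lambda>r. green_function T m t r) has_real_derivative
      - sgn (t - s) * sin (m * (T - \<bar>t - s\<bar>)) / (2 * sin (m * T))) (at s within {-T..T})"
proof -
  \<comment> \<open>Near \<open>s\<close> the sign of \<open>t - r\<close> is constant, so the absolute value in the kernel is
    a linear function of \<open>r\<close>.\<close>
  define \<sigma> where "\<sigma> = sgn (t - s)"
  have abs_eq: "\<bar>t - r\<bar> = \<sigma> * (t - r)" if "dist r s < \<bar>t - s\<bar>" for r
    using that by (auto simp: \<sigma>_def sgn_if dist_real_def abs_if split: if_splits)
  have "((\<lambda>r. cos (m * (T - \<sigma> * (t - r))) / (2 * m * sin (m * T))) has_real_derivative
      - sin (m * (T - \<sigma> * (t - s))) * (m * \<sigma>) / (2 * m * sin (m * T))) (at s within {-T..T})"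
    by (rule derivative_eq_intros refl | simp add: m)+
  also have "- sin (m * (T - \<sigma> * (t - s))) * (m * \<sigma>) / (2 * m * sin (m * T))
      = - \<sigma> * sin (m * (T - \<bar>t - s\<bar>)) / (2 * sin (m * T))"
    using m abs_eq[of s] \<open>s \<noteq> t\<close> by (simp add: mult.commute)
  finally show ?thesis
    unfolding \<sigma>_def[symmetric]
  proof (rule has_field_derivative_transform_within)
    show "\<bar>t - s\<bar> > 0" using \<open>s \<noteq> t\<close> by simp
    show "cos (m * (T - \<sigma> * (t - r))) / (2 * m * sin (m * T)) = green_function T m t r"
      if "r \<in> {-T..T}" "dist r s < \<bar>t - s\<bar>" for r
      using green_function_eq_kernel[OF assms(1-3) t that(1)] abs_eq[OF that(2)]
      by (simp add: periodic_kernel_def)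
  qed (rule s)
qed

lemma green_bar_formula:
  assumes "T > 0" and m: "m \<noteq> 0" "sin (m * T) \<noteq> 0"
    and t: "t \<in> {-T..T}" and s: "s \<in> {-T..T}" and "s \<noteq> t"
  shows "green_bar T m t s =
      (cos (m * (T - \<bar>t + s\<bar>)) + sgn (t - s) * sin (m * (T - \<bar>t - s\<bar>))) / (2 * sin (m * T))"
proof -
  have "vector_derivative (\<lambda>r. green_function T m t r) (at s within {-T..T})
      = - sgn (t - s) * sin (m * (T - \<bar>t - s\<bar>)) / (2 * sin (m * T))"
    using \<open>T > 0\<close> s green_function_has_real_derivative[OF assms]
    by (intro vector_derivative_within_closed_interval)
       (auto simp: has_real_derivative_iff_has_vector_derivative)
  moreover have "m * green_function T m t (-s) = cos (m * (T - \<bar>t + s\<bar>)) / (2 * sin (m * T))"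
    using green_function_eq_kernel[OF assms(1-3) t, of "-s"] s m by (simp add: periodic_kernel_def)
  ultimately show ?thesis
    unfolding green_bar_def by (simp add: add_divide_distrib)
qed

text \<open>This is \<open>2 sin (m T) u(t)\<close> for the candidate solution \<open>u\<close>. The first three lines come from the part
  of the kernel with corner at \<open>s = -t\<close>, the others from the part that jumps at \<open>s = t\<close>.\<close>

definition reflection_numerator :: "real \<Rightarrow> real \<Rightarrow> (real \<Rightarrow> real) \<Rightarrow> real \<Rightarrow> real" where
  "reflection_numerator T m h t =
     cos (m * (T + t)) * cos_moment T m h (-t) - sin (m * (T + t)) * sin_moment T m h (-t)
   + cos (m * (T - t)) * (cos_moment T m h T - cos_moment T m h (-t))
   + sin (m * (T - t)) * (sin_moment T m h T - sin_moment T m h (-t))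
   + sin (m * (T - t)) * cos_moment T m h t + cos (m * (T - t)) * sin_moment T m h t
   - sin (m * (T + t)) * (cos_moment T m h T - cos_moment T m h t)
   + cos (m * (T + t)) * (sin_moment T m h T - sin_moment T m h t)"

lemma green_bar_integral:
  assumes "T > 0" and m: "m \<noteq> 0" "sin (m * T) \<noteq> 0"
    and h: "h absolutely_integrable_on {-T..T}" and t: "t \<in> {-T..T}"
  shows "(\<lambda>s. green_bar T m t s * h s) absolutely_integrable_on {-T..T}"
    and "(LINT s:{-T..T}|lebesgue. green_bar T m t s * h s) = reflection_numerator T m h t / (2 * sin (m * T))"
proof -
  define kA where "kA s = cos (m * (T - \<bar>t + s\<bar>))" for s
  define kB where "kB s = sgn (t - s) * sin (m * (T - \<bar>t - s\<bar>))" for s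
  have t': "-t \<in> {-T..T}" using t by simp
  have A1: "kA s = cos (m * (T + t)) * cos (m * s) + (- sin (m * (T + t))) * sin (m * s)"
    if "s \<in> {-T..T}" "s < -t" for s
  proof -
    have "m * (T - \<bar>t + s\<bar>) = m * (T + t) + m * s" using that by (simp add: algebra_simps)
    then show ?thesis by (simp add: kA_def cos_add)
  qed
  have A2: "kA s = cos (m * (T - t)) * cos (m * s) + sin (m * (T - t)) * sin (m * s)"
    if "s \<in> {-T..T}" "s > -t" for s
  proof -
    have "m * (T - \<bar>t + s\<bar>) = m * (T - t) - m * s" using that by (simp add: algebra_simps)
    then show ?thesis by (simp add: kA_def cos_diff)
  qed
  have B1: "kB s = sin (m * (T - t)) * cos (m * s) + cos (m * (T - t)) * sin (m * s)"
    if "s \<in> {-T..T}" "s < t" for s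
  proof -
    have "m * (T - \<bar>t - s\<bar>) = m * (T - t) + m * s" using that by (simp add: algebra_simps)
    then show ?thesis using that by (simp add: kB_def sin_add)
  qed
  have B2: "kB s = (- sin (m * (T + t))) * cos (m * s) + cos (m * (T + t)) * sin (m * s)"
    if "s \<in> {-T..T}" "s > t" for s
  proof -
    have "m * (T - \<bar>t - s\<bar>) = m * (T + t) - m * s" using that by (simp add: algebra_simps)
    then show ?thesis using that by (simp add: kB_def sin_diff)
  qed
  have A: "(\<lambda>s. kA s * h s) absolutely_integrable_on {-T..T}"
    by (rule piecewise_trig_kernel_integral(1)[OF h t' A1 A2])
  have B: "(\<lambda>s. kB s * h s) absolutely_integrable_on {-T..T}"
    by (rule piecewise_trig_kernel_integral(1)[OF h t B1 B2])
  define c where "c = 1 / (2 * sin (m * T))"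
  have AB: "(\<lambda>s. c * (kA s * h s + kB s * h s)) absolutely_integrable_on {-T..T}"
    by (intro set_integrable_mult_right set_integral_add A B)
  have eq: "green_bar T m t s * h s = c * (kA s * h s + kB s * h s)" if "s \<in> {-T..T} - {t}" for s
    using green_bar_formula[OF assms(1-3) t, of s] that
    by (simp add: c_def kA_def kB_def distrib_right)
  show int: "(\<lambda>s. green_bar T m t s * h s) absolutely_integrable_on {-T..T}"
    by (rule absolutely_integrable_spike[OF AB, of "{t}"]) (use eq in auto)
  have "(LINT s:{-T..T}|lebesgue. green_bar T m t s * h s) = integral {-T..T} (\<lambda>s. green_bar T m t s * h s)"
    by (rule set_lebesgue_integral_eq_integral(2)[OF int])
  also have "\<dots> = integral {-T..T} (\<lambda>s. c * (kA s * h s + kB s * h s))"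
    by (rule integral_spike[of "{t}"]) (use eq in auto)
  also have "\<dots> = c * (integral {-T..T} (\<lambda>s. kA s * h s) + integral {-T..T} (\<lambda>s. kB s * h s))"
    using integral_add[OF set_lebesgue_integral_eq_integral(1)[OF A] set_lebesgue_integral_eq_integral(1)[OF B]]
    by simp
  also have "integral {-T..T} (\<lambda>s. kA s * h s) =
        cos (m * (T + t)) * cos_moment T m h (-t) + (- sin (m * (T + t))) * sin_moment T m h (-t)
      + cos (m * (T - t)) * (cos_moment T m h T - cos_moment T m h (-t))
      + sin (m * (T - t)) * (sin_moment T m h T - sin_moment T m h (-t))"
    by (rule piecewise_trig_kernel_integral(2)[OF h t' A1 A2])
  also have "integral {-T..T} (\<lambda>s. kB s * h s) =
        sin (m * (T - t)) * cos_moment T m h t + cos (m * (T - t)) * sin_moment T m h t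
      + (- sin (m * (T + t))) * (cos_moment T m h T - cos_moment T m h t)
      + cos (m * (T + t)) * (sin_moment T m h T - sin_moment T m h t)"
    by (rule piecewise_trig_kernel_integral(2)[OF h t B1 B2])
  finally have "(LINT s:{-T..T}|lebesgue. green_bar T m t s * h s) = c * reflection_numerator T m h t"
    by (simp add: reflection_numerator_def)
  then show "(LINT s:{-T..T}|lebesgue. green_bar T m t s * h s)
      = reflection_numerator T m h t / (2 * sin (m * T))"
    by (simp add: c_def)
qed

lemma has_real_derivative_reflect_within:
  fixes F :: "real \<Rightarrow> real"
  assumes "(F has_real_derivative D) (at (-t) within {-T..T})"
  shows "((\<lambda>x. F (-x)) has_real_derivative - D) (at t within {-T..T})"
proof -
  have "uminus ` {-T..T} = {-T..T}" by simp
  then have "(F has_real_derivative D) (at (-t) within uminus ` {-T..T})" using assms by simp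
  moreover have "(uminus has_real_derivative - 1) (at t within {-T..T})"
    by (auto intro!: derivative_eq_intros)
  ultimately have "(F \<circ> uminus has_real_derivative D * - 1) (at t within {-T..T})"
    by (rule DERIV_image_chain)
  then show ?thesis by (simp add: o_def)
qed

text \<open>The part of the kernel with corner at \<open>-t\<close> is continuous there, so \<open>h(-t)\<close> cancels; the other part
  jumps by \<open>2 sin (m T)\<close> at \<open>t\<close>, which is the coefficient of \<open>h(t)\<close>. Differentiation of the trigonometric
  coefficients interchanges the two parts, up to the factor \<open>-m\<close> and the reflection of \<open>t\<close>.\<close>

lemma reflection_numerator_has_derivative:
  assumes "(cos_moment T m h has_real_derivative cos (m * t) * h t) (at t within {-T..T})"
    and "(sin_moment T m h has_real_derivative sin (m * t) * h t) (at t within {-T..T})"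
    and "(cos_moment T m h has_real_derivative cos (m * - t) * h (-t)) (at (-t) within {-T..T})"
    and "(sin_moment T m h has_real_derivative sin (m * - t) * h (-t)) (at (-t) within {-T..T})"
  shows "(reflection_numerator T m h has_real_derivative
     2 * sin (m * T) * h t - m * reflection_numerator T m h (-t)) (at t within {-T..T})"
proof -
  note D = assms(1,2) has_real_derivative_reflect_within[OF assms(3)]
    has_real_derivative_reflect_within[OF assms(4)]
  have "((\<lambda>t. reflection_numerator T m h t) has_real_derivative
     2 * sin (m * T) * h t - m * reflection_numerator T m h (-t)) (at t within {-T..T})"
    unfolding reflection_numerator_def
    apply (rule derivative_eq_intros D refl)+
    using arg_cong2[OF trig_shift_identities(1,2)[of m T t], of "\<lambda>x y. h (-t) * (x - y)"]
      arg_cong2[OF trig_shift_identities(3,4)[of m T t], of "\<lambda>x y. h t * (x + y)"]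
    by (simp add: algebra_simps)
  then show ?thesis by simp
qed

lemma abs_continuous_on_reflection_numerator:
  assumes h: "h absolutely_integrable_on {-T..T}"
  shows "abs_continuous_on {-T..T} (reflection_numerator T m h)"
proof -
  have C: "abs_continuous_on {-T..T} (\<lambda>t. cos_moment T m h t)"
    and S: "abs_continuous_on {-T..T} (\<lambda>t. sin_moment T m h t)"
    unfolding cos_moment_def sin_moment_def
    by (intro abs_continuous_on_indefinite_integral absolutely_integrable_trig_mult h)+
  have "abs_continuous_on {-T..T} (\<lambda>t. reflection_numerator T m h t)"
    unfolding reflection_numerator_def
    by (intro abs_continuous_on_add abs_continuous_on_diff abs_continuous_on_mult
        abs_continuous_on_trig_shift abs_continuous_on_const C S
        abs_continuous_on_reflect[OF C] abs_continuous_on_reflect[OF S])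
  then show ?thesis by simp
qed

text \<open>A point is good when the moments are differentiable both there and at its mirror image; the
  mirror image of a null set is a null set.\<close>

lemma AE_reflection_numerator_derivative:
  assumes h: "h absolutely_integrable_on {-T..T}"
  shows "AE t\<in>{-T..T} in lebesgue. (reflection_numerator T m h has_real_derivative
     2 * sin (m * T) * h t - m * reflection_numerator T m h (-t)) (at t within {-T..T})"
proof -
  define bad where "bad = {t \<in> {-T..T}.
        \<not> (cos_moment T m h has_real_derivative cos (m * t) * h t) (at t within {-T..T})}
      \<union> {t \<in> {-T..T}. \<not> (sin_moment T m h has_real_derivative sin (m * t) * h t) (at t within {-T..T})}"
  have "negligible bad"
    unfolding bad_def
  proof (rule negligible_Un)
    show "negligible {t \<in> {-T..T}.
        \<not> (cos_moment T m h has_real_derivative cos (m * t) * h t) (at t within {-T..T})}"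
      using indefinite_integral_has_real_derivative_ae[OF
          set_lebesgue_integral_eq_integral(1)[OF absolutely_integrable_trig_mult(1)[OF h, of m]]]
      unfolding cos_moment_def[abs_def] .
    show "negligible {t \<in> {-T..T}.
        \<not> (sin_moment T m h has_real_derivative sin (m * t) * h t) (at t within {-T..T})}"
      using indefinite_integral_has_real_derivative_ae[OF
          set_lebesgue_integral_eq_integral(1)[OF absolutely_integrable_trig_mult(2)[OF h, of m]]]
      unfolding sin_moment_def[abs_def] .
  qed
  moreover have "negligible (uminus ` bad)"
    by (rule negligible_differentiable_image_negligible[OF _ \<open>negligible bad\<close>])
       (auto intro!: derivative_intros)
  ultimately have "bad \<union> uminus ` bad \<in> null_sets lebesgue"
    by (simp flip: negligible_iff_null_sets)
  then show ?thesis
  proof (rule AE_I')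
    have "(reflection_numerator T m h has_real_derivative
        2 * sin (m * T) * h t - m * reflection_numerator T m h (-t)) (at t within {-T..T})"
      if "t \<in> {-T..T}" "t \<notin> bad" "-t \<notin> bad" for t
      using that by (intro reflection_numerator_has_derivative) (auto simp: bad_def)
    moreover have "t \<in> uminus ` bad" if "-t \<in> bad" for t
      using that by (metis add.inverse_inverse imageI)
    ultimately show "{t \<in> space lebesgue. \<not> (t \<in> {-T..T} \<longrightarrow> (reflection_numerator T m h has_real_derivative
        2 * sin (m * T) * h t - m * reflection_numerator T m h (-t)) (at t within {-T..T}))}
        \<subseteq> bad \<union> uminus ` bad"
      by blast
  qed
qed

text \<open>Integrating the almost everywhere equation turns \<open>z\<close> into an indefinite integral of a continuous
  function, which upgrades it to an equation valid everywhere; that equation can be differentiated,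
  and the result is the homogeneous periodic problem of second order.\<close>

lemma reflection_solution_zero_unique:
  assumes "T > 0" and m: "m \<noteq> 0" "sin (m * T) \<noteq> 0"
    and z: "reflection_solution T m (\<lambda>_. 0) z" and t: "t \<in> {-T..T}"
  shows "z t = 0"
proof -
  have ac: "abs_continuous_on {-T..T} z" and bc: "z T - z (-T) = 0"
    and ae: "AE t\<in>{-T..T} in lebesgue. (z has_real_derivative 0 - m * z (-t)) (at t within {-T..T})"
    using z by (simp_all add: reflection_solution_def)
  obtain N where N: "negligible N"
    and dN: "\<And>t. t \<in> {-T..T} - N \<Longrightarrow> (z has_real_derivative 0 - m * z (-t)) (at t within {-T..T})"
    using ae unfolding eventually_ae_filter negligible_iff_null_sets by auto
  have cont: "continuous_on {-T..T} (\<lambda>s. 0 - m * z (-s))"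
    by (intro continuous_intros abs_continuous_on_imp_continuous_on abs_continuous_on_reflect ac)
  have z_eq: "z (-T) + integral {-T..t} (\<lambda>s. 0 - m * z (-s)) = z t" if t: "t \<in> {-T..T}" for t
  proof -
    have sub: "{-T..t} \<subseteq> {-T..T}" using t by auto
    have "((\<lambda>s. 0 - m * z (-s)) has_integral z t - z (-T)) {-T..t}"
    proof (rule abs_continuous_has_integral[OF abs_continuous_on_subset[OF ac sub] _ N])
      show "(z has_real_derivative 0 - m * z (-s)) (at s within {-T..t})" if "s \<in> {-T..t} - N" for s
        by (rule DERIV_subset[OF dN sub]) (use that sub in auto)
    qed (use t in auto)
    from integral_unique[OF this] show ?thesis by simp
  qed
  have z1: "(z has_real_derivative 0 - m * z (-t)) (at t within {-T..T})" if t: "t \<in> {-T..T}" for t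
  proof -
    have "((\<lambda>t. z (-T) + integral {-T..t} (\<lambda>s. 0 - m * z (-s))) has_real_derivative 0 + (0 - m * z (-t)))
        (at t within {-T..T})"
      by (intro DERIV_add DERIV_const integral_has_real_derivative cont t)
    from has_real_derivative_cong_within[OF this t z_eq] show ?thesis by simp
  qed
  have "periodic_solution2 T m (\<lambda>_. 0) z"
    unfolding periodic_solution2_def
  proof (intro exI[of _ "\<lambda>t. 0 - m * z (-t)"] conjI ballI)
    fix t assume t: "t \<in> {-T..T}"
    then have "-t \<in> {-T..T}" by simp
    from has_real_derivative_reflect_within[OF z1[OF this]]
    have "((\<lambda>x. z (- x)) has_real_derivative m * z t) (at t within {-T..T})" by simp
    from DERIV_diff[OF DERIV_const[of 0] DERIV_cmult[OF this, of m]]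
    show "((\<lambda>t. 0 - m * z (- t)) has_real_derivative 0 - m\<^sup>2 * z t) (at t within {-T..T})"
      by (simp add: power2_eq_square mult.assoc)
  qed (use bc z1 in auto)
  from periodic_solution2_zero_unique[OF assms(1-3) this t] show ?thesis .
qed

lemma reflection_solution_unique:
  assumes "T > 0" "m \<noteq> 0" "sin (m * T) \<noteq> 0"
    and x: "reflection_solution T m h x" and y: "reflection_solution T m h y" and t: "t \<in> {-T..T}"
  shows "x t = y t"
proof -
  have "reflection_solution T m (\<lambda>_. 0) (\<lambda>t. x t - y t)"
    unfolding reflection_solution_def
  proof (intro conjI)
    show "abs_continuous_on {-T..T} (\<lambda>t. x t - y t)"
      using x y by (intro abs_continuous_on_diff) (auto simp: reflection_solution_def)
    have "AE t\<in>{-T..T} in lebesgue. (x has_real_derivative h t - m * x (-t)) (at t within {-T..T})"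
      "AE t\<in>{-T..T} in lebesgue. (y has_real_derivative h t - m * y (-t)) (at t within {-T..T})"
      using x y by (auto simp: reflection_solution_def)
    then show "AE t\<in>{-T..T} in lebesgue. ((\<lambda>t. x t - y t) has_real_derivative
        0 - m * (x (-t) - y (-t))) (at t within {-T..T})"
    proof eventually_elim
      case (elim t)
      show ?case
      proof
        assume "t \<in> {-T..T}"
        with elim have "((\<lambda>t. x t - y t) has_real_derivative
            (h t - m * x (-t)) - (h t - m * y (-t))) (at t within {-T..T})"
          by (intro DERIV_diff) auto
        then show "((\<lambda>t. x t - y t) has_real_derivative 0 - m * (x (-t) - y (-t))) (at t within {-T..T})"
          by (simp add: algebra_simps)
      qed
    qed
  qed (use x y in \<open>auto simp: reflection_solution_def\<close>)
  from reflection_solution_zero_unique[OF assms(1-3) this t] show ?thesis by simp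
qed

lemma reflection_solution_green_bar:
  assumes "T > 0" and m: "m \<noteq> 0" "sin (m * T) \<noteq> 0" and h: "h absolutely_integrable_on {-T..T}"
  shows "reflection_solution T m h (\<lambda>t. LINT s:{-T..T}|lebesgue. green_bar T m t s * h s)"
proof -
  define u where "u t = (LINT s:{-T..T}|lebesgue. green_bar T m t s * h s)" for t
  define c where "c = 2 * sin (m * T)"
  have "c \<noteq> 0" using m by (simp add: c_def)
  have u: "reflection_numerator T m h t / c = u t" if "t \<in> {-T..T}" for t
    unfolding u_def c_def by (rule green_bar_integral(2)[OF assms that, symmetric])
  have "reflection_solution T m h u"
    unfolding reflection_solution_def
  proof (intro conjI)
    have "abs_continuous_on {-T..T} (\<lambda>t. 1 / c * reflection_numerator T m h t)"
      by (intro abs_continuous_on_mult abs_continuous_on_const abs_continuous_on_reflection_numerator h)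
    then show "abs_continuous_on {-T..T} u"
      by (rule abs_continuous_on_cong) (use u in simp)
    show "AE t\<in>{-T..T} in lebesgue. (u has_real_derivative h t - m * u (-t)) (at t within {-T..T})"
      using AE_reflection_numerator_derivative[OF h, of m]
    proof eventually_elim
      case (elim t)
      show ?case
      proof
        assume t: "t \<in> {-T..T}"
        with elim have "(reflection_numerator T m h has_real_derivative
            c * h t - m * reflection_numerator T m h (-t)) (at t within {-T..T})"
          by (simp add: c_def)
        from has_real_derivative_cong_within[OF DERIV_cdivide[OF this, of c] t u]
        have "(u has_real_derivative (c * h t - m * reflection_numerator T m h (-t)) / c) (at t within {-T..T})" .
        moreover have "u (-t) = reflection_numerator T m h (-t) / c"
          using u[of "-t"] t by simp
        then have "(c * h t - m * reflection_numerator T m h (-t)) / c = h t - m * u (-t)"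
          using \<open>c \<noteq> 0\<close> by (simp add: diff_divide_distrib)
        ultimately show "(u has_real_derivative h t - m * u (-t)) (at t within {-T..T})" by simp
      qed
    qed
    have "T \<in> {-T..T}" "-T \<in> {-T..T}" using \<open>T > 0\<close> by auto
    from u[OF this(1)] u[OF this(2)] show "u T - u (-T) = 0"
      by (simp add: reflection_numerator_def)
  qed
  then show ?thesis unfolding u_def .
qed

theorem proposition3p2:
  fixes T m :: real and h :: "real \<Rightarrow> real"
  defines "u \<equiv> (\<lambda>t. LINT s:{-T..T}|lebesgue. green_bar T m t s * h s)"
  assumes "T > 0"
    and "\<forall>k::int. m \<noteq> of_int k * pi / T"
    and "set_integrable lebesgue {-T..T} h"
  shows "(\<forall>t\<in>{-T..T}. \<forall>s\<in>{-T..T}. t \<noteq> s \<longrightarrow>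
            (\<lambda>\<sigma>. green_function T m t \<sigma>) differentiable (at s within {-T..T})) \<and>
         (\<forall>t\<in>{-T..T}. set_integrable lebesgue {-T..T} (\<lambda>s. green_bar T m t s * h s)) \<and>
         reflection_solution T m h u \<and>
         (\<forall>x. reflection_solution T m h x \<longrightarrow> (\<forall>t\<in>{-T..T}. x t = u t))"
proof -
  note m = nonresonant[OF assms(2,3)]
  have u: "reflection_solution T m h u"
    unfolding u_def by (rule reflection_solution_green_bar[OF assms(2) m assms(4)])
  show ?thesis
  proof (intro conjI ballI allI impI)
    show "(\<lambda>\<sigma>. green_function T m t \<sigma>) differentiable (at s within {-T..T})"
      if "t \<in> {-T..T}" "s \<in> {-T..T}" "t \<noteq> s" for t s
      using green_function_has_real_derivative[OF assms(2) m that(1,2)] that(3)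
      by (auto simp: real_differentiable_def)
    show "set_integrable lebesgue {-T..T} (\<lambda>s. green_bar T m t s * h s)" if "t \<in> {-T..T}" for t
      by (rule green_bar_integral(1)[OF assms(2) m assms(4) that])
    show "reflection_solution T m h u" by (rule u)
    show "x t = u t" if "reflection_solution T m h x" "t \<in> {-T..T}" for x t
      by (rule reflection_solution_unique[OF assms(2) m that(1) u that(2)])
  qed
qed

end
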